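(* Let $\mathcal{M}=(S,\mathit{Act},P,\mathsf{init})$ be a finite MDP in which every state is reachable from $\mathsf{init}$, let $\mathsf{Eff}\subseteq S\setminus\{\mathsf{init}\}$ be a nonempty set of terminal states, and let $\mathsf{Cause}\subseteq S\setminus\mathsf{Eff}$ be a nonempty set satisfying condition (M). If $\mathsf{Cause}$ is not a GPR cause for $\mathsf{Eff}$ in $\mathcal{M}$, then (i) there is an MR-scheduler $\mathfrak{S}$ for $\mathcal{M}_{\min}^{\mathsf{Cause}}$ with $\mathrm{Pr}^{\mathfrak{S}}_{\mathcal{M}_{\min}^{\mathsf{Cause}}}(\Diamond\mathsf{Cause})>0$ and $\mathrm{Pr}^{\mathfrak{S}}_{\mathcal{M}_{\min}^{\mathsf{Cause}}}(\Diamond\mathsf{Eff}\mid\Diamond\mathsf{Cause})\le \mathrm{Pr}^{\mathfrak{S}}_{\mathcal{M}_{\min}^{\mathsf{Cause}}}(\Diamond\mathsf{Eff})$, and (ii) there is a finite-memory scheduler $\mathfrak{T}$ for $\mathcal{M}$ with two memory cells such that $\mathrm{Pr}^{\mathfrak{T}}_{\mathcal{M}}(\Diamond\mathsf{Cause})>0$ and $\mathrm{Pr}^{\mathfrak{T}}_{\mathcal{M}}(\Diamond\mathsf{Eff}\mid\Diamond\mathsf{Cause})\le \mathrm{Pr}^{\mathfrak{T}}_{\mathcal{M}}(\Diamond\mathsf{Eff})$.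
   Context: An MDP is $\mathcal{M}=(S,\mathit{Act},P,\mathsf{init})$ with finite $S$, finite $\mathit{Act}$, $P:S\times\mathit{Act}\times S\to[0,1]$, $\sum_tP(s,\alpha,t)\in\{0,1\}$; $\alpha$ enabled in $s$ iff the sum is $1$, $\mathit{Act}(s)$ the enabled actions, $s$ terminal iff $\mathit{Act}(s)=\emptyset$. A scheduler maps finite non-maximal paths to distributions over enabled actions of the last state; it is memoryless randomized (MR) if its choice depends only on the last state; it is finite-memory with two memory cells if it is representable by a finite automaton with two states (memory cells) that determine, together with the current state, the action distribution. $\mathrm{Pr}^{\mathfrak{S}}_{\mathcal{M}}$ is the induced measure from $\mathsf{init}$. $X\,\mathrm{U}\,T$: paths reaching $T$ while staying in $X$ before; $\neg X=S\setminus X$; $\Diamond T=S\,\mathrm{U}\,T$. Condition (M): for each $c\in\mathsf{Cause}$ some scheduler has $\mathrm{Pr}_{\mathcal{M}}((\neg\mathsf{Cause})\,\mathrm{U}\,c)>0$. Condition (G): every scheduler $\mathfrak{S}$ with $\mathrm{Pr}^{\mathfrak{S}}_{\mathcal{M}}(\Diamond\mathsf{Cause})>0$ satisfies $\mathrm{Pr}^{\mathfrak{S}}_{\mathcal{M}}(\Diamond\mathsf{Eff}\mid\Diamond\mathsf{Cause})>\mathrm{Pr}^{\mathfrak{S}}_{\mathcal{M}}(\Diamond\mathsf{Eff})$. $\mathsf{Cause}$ is a GPR cause iff (G) and (M) hold. For $C\subseteq S$, $\mathcal{M}_{\min}^{C}$ is the MDP obtained from $\mathcal{M}$ by removing all enabled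 actions of states in $C$ and adding a new action $\gamma$ enabled exactly in the states $s\in C$, with $P(s,\gamma,\mathsf{eff})=\mathrm{Pr}^{\min}_{\mathcal{M},s}(\Diamond\mathsf{Eff})$ and $P(s,\gamma,\mathsf{noeff})=1-\mathrm{Pr}^{\min}_{\mathcal{M},s}(\Diamond\mathsf{Eff})$, where $\mathsf{eff}$ is a fixed state in $\mathsf{Eff}$ and $\mathsf{noeff}$ is a (possibly fresh) terminal state not in $\mathsf{Eff}$; here $\mathrm{Pr}^{\min}_{\mathcal{M},s}$ is the infimum over all schedulers of the probability when starting in $s$. *)

theory Defs
  imports "HOL-Probability.Probability"
begin

record ('s, 'a) mdp =
  states :: "'s set"
  acts :: "'a set"
  trans_prob :: "'s \<Rightarrow> 'a \<Rightarrow> 's \<Rightarrow> real"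
  init :: 's

definition is_mdp :: "('s, 'a) mdp \<Rightarrow> bool" where
  "is_mdp M \<longleftrightarrow>
     finite (states M) \<and> finite (acts M) \<and> init M \<in> states M \<and>
     (\<forall>s\<in>states M. \<forall>\<alpha>\<in>acts M.
        (\<forall>t\<in>states M. 0 \<le> trans_prob M s \<alpha> t \<and> trans_prob M s \<alpha> t \<le> 1) \<and>
        (\<Sum>t\<in>states M. trans_prob M s \<alpha> t) \<in> {0, 1})"

definition enabled :: "('s, 'a) mdp \<Rightarrow> 's \<Rightarrow> 'a set" where
  "enabled M s = {\<alpha> \<in> acts M. (\<Sum>t\<in>states M. trans_prob M s \<alpha> t) = 1}"

definition terminal :: "('s, 'a) mdp \<Rightarrow> 's \<Rightarrow> bool" where
  "terminal M s \<longleftrightarrow> enabled M s = {}"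

definition edges :: "('s, 'a) mdp \<Rightarrow> ('s \<times> 's) set" where
  "edges M = {(s, t). s \<in> states M \<and> t \<in> states M \<and> (\<exists>\<alpha>\<in>enabled M s. trans_prob M s \<alpha> t > 0)}"

text \<open>
  The finite path \<open>s\<^sub>0 \<alpha>\<^sub>0 s\<^sub>1 \<alpha>\<^sub>1 \<dots> s\<^sub>n\<close> is given to a scheduler as the list
  \<open>[(s\<^sub>0, \<alpha>\<^sub>0), \<dots>, (s\<^sub>n\<^sub>-\<^sub>1, \<alpha>\<^sub>n\<^sub>-\<^sub>1)]\<close> together with the last state \<open>s\<^sub>n\<close>. Schedulers are
  total functions: on lists that are not paths of the MDP they take some
  distribution over the actions enabled in the last state, and on maximal paths an arbitrary one;
  neither influences the induced measure.
\<close>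

type_synonym ('s, 'a) scheduler = "('s \<times> 'a) list \<Rightarrow> 's \<Rightarrow> 'a pmf"

definition is_scheduler :: "('s, 'a) mdp \<Rightarrow> ('s, 'a) scheduler \<Rightarrow> bool" where
  "is_scheduler M \<SS> \<longleftrightarrow>
     (\<forall>h. \<forall>s\<in>states M. \<not> terminal M s \<longrightarrow> set_pmf (\<SS> h s) \<subseteq> enabled M s)"

definition memoryless :: "('s, 'a) scheduler \<Rightarrow> bool" where
  "memoryless \<SS> \<longleftrightarrow> (\<exists>\<delta>. \<forall>h s. \<SS> h s = \<delta> s)"

text \<open>
  The memory is a deterministic automaton with cells \<open>{..<k}\<close> that reads the path; the action
  distribution is determined by its current cell and the current state.
\<close>

definition finite_memory :: "nat \<Rightarrow> ('s, 'a) scheduler \<Rightarrow> bool" where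
  "finite_memory k \<SS> \<longleftrightarrow>
     (\<exists>(q\<^sub>0 :: nat) (upd :: nat \<Rightarrow> 's \<times> 'a \<Rightarrow> nat) (act :: nat \<Rightarrow> 's \<Rightarrow> 'a pmf).
        q\<^sub>0 < k \<and> (\<forall>q<k. \<forall>x. upd q x < k) \<and>
        (\<forall>h s. \<SS> h s = act (foldl upd q\<^sub>0 h) s))"

text \<open>
  A maximal path is a sequence \<open>\<omega>\<close> where \<open>\<omega> n\<close> consists of the action leading to the
  \<open>n\<close>-th state and that state. The action is \<open>None\<close> for \<open>n = 0\<close>. A maximal path that
  ends in a terminal state is continued by repeating that state with \<open>None\<close>.
\<close>

type_synonym ('s, 'a) run = "nat \<Rightarrow> 'a option \<times> 's"

definition step_space :: "('s, 'a) mdp \<Rightarrow> ('a option \<times> 's) measure" where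
  "step_space M = count_space (insert None (Some ` acts M) \<times> states M)"

definition history :: "('s, 'a) run \<Rightarrow> nat \<Rightarrow> ('s \<times> 'a) list" where
  "history \<omega> n = map (\<lambda>i. (snd (\<omega> i), the (fst (\<omega> (Suc i))))) [0..<n]"

primrec step_prob ::
  "('s, 'a) mdp \<Rightarrow> ('s, 'a) scheduler \<Rightarrow> 's \<Rightarrow> nat \<Rightarrow> ('s, 'a) run \<Rightarrow> 'a option \<times> 's \<Rightarrow> real" where
  "step_prob M \<SS> s\<^sub>0 0 \<omega> x = (if x = (None, s\<^sub>0) then 1 else 0)"
| "step_prob M \<SS> s\<^sub>0 (Suc n) \<omega> x =
     (let s = snd (\<omega> n) in
      if terminal M s then (if x = (None, s) then 1 else 0)
      else (case x of
              (None, t) \<Rightarrow> 0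
            | (Some \<alpha>, t) \<Rightarrow> pmf (\<SS> (history \<omega> n) s) \<alpha> * trans_prob M s \<alpha> t))"

definition step_kernel ::
  "('s, 'a) mdp \<Rightarrow> ('s, 'a) scheduler \<Rightarrow> 's \<Rightarrow> nat \<Rightarrow> ('s, 'a) run \<Rightarrow> ('a option \<times> 's) measure" where
  "step_kernel M \<SS> s\<^sub>0 n \<omega> = density (step_space M) (\<lambda>x. ennreal (step_prob M \<SS> s\<^sub>0 n \<omega> x))"

definition path_measure ::
  "('s, 'a) mdp \<Rightarrow> ('s, 'a) scheduler \<Rightarrow> 's \<Rightarrow> ('s, 'a) run measure" where
  "path_measure M \<SS> s\<^sub>0 =
     projective_family.lim UNIV
       (Ionescu_Tulcea.CI (step_kernel M \<SS> s\<^sub>0) (\<lambda>_. step_space M)) (\<lambda>_. step_space M)"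

lemma Ionescu_Tulcea_step_kernel:
  assumes M: "is_mdp M" and S: "is_scheduler M \<SS>" and s0: "s\<^sub>0 \<in> states M"
  shows "Ionescu_Tulcea (step_kernel M \<SS> s\<^sub>0) (\<lambda>_. step_space M)"
proof -
  let ?C = "insert None (Some ` acts M) \<times> states M"
  have fin: "finite (states M)" "finite (acts M)"
    using M by (auto simp: is_mdp_def)
  have finC: "finite ?C" using fin by auto
  have sum1: "(\<Sum>x\<in>?C. step_prob M \<SS> s\<^sub>0 n \<omega> x) = 1" and nonneg: "\<forall>x\<in>?C. 0 \<le> step_prob M \<SS> s\<^sub>0 n \<omega> x"
    if w: "\<omega> \<in> {0..<n} \<rightarrow>\<^sub>E ?C" for n \<omega>
  proof -
    have *: "(\<Sum>x\<in>?C. step_prob M \<SS> s\<^sub>0 n \<omega> x) = 1 \<and> (\<forall>x\<in>?C. 0 \<le> step_prob M \<SS> s\<^sub>0 n \<omega> x)"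
    proof (cases n)
      case 0
      then show ?thesis using s0 finC by (simp add: sum.delta)
    next
      case (Suc m)
      define s where "s = snd (\<omega> m)"
      have "\<omega> m \<in> ?C" using w Suc by (intro PiE_mem[OF w]) simp
      then have s: "s \<in> states M" by (auto simp: s_def)
      show ?thesis
      proof (cases "terminal M s")
        case True
        then show ?thesis using s finC Suc by (simp add: sum.delta Let_def s_def)
      next
        case False
        define p where "p = \<SS> (history \<omega> m) s"
        have sub: "set_pmf p \<subseteq> enabled M s"
          using S s False by (auto simp: is_scheduler_def p_def)
        have eq: "step_prob M \<SS> s\<^sub>0 n \<omega> (a, t) =
            (case a of None \<Rightarrow> 0 | Some \<alpha> \<Rightarrow> pmf p \<alpha> * trans_prob M s \<alpha> t)" for a t
          using False Suc by (simp add: Let_def s_def p_def split: option.split)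
        have "(\<Sum>x\<in>?C. step_prob M \<SS> s\<^sub>0 n \<omega> x)
            = (\<Sum>a\<in>insert None (Some ` acts M). \<Sum>t\<in>states M. step_prob M \<SS> s\<^sub>0 n \<omega> (a, t))"
          by (simp add: sum.cartesian_product)
        also have "\<dots> = (\<Sum>\<alpha>\<in>acts M. pmf p \<alpha> * (\<Sum>t\<in>states M. trans_prob M s \<alpha> t))"
          using fin by (simp add: eq sum.reindex sum_distrib_left)
        also have "\<dots> = (\<Sum>\<alpha>\<in>acts M. pmf p \<alpha>)"
        proof (rule sum.cong[OF refl])
          fix \<alpha> show "pmf p \<alpha> * (\<Sum>t\<in>states M. trans_prob M s \<alpha> t) = pmf p \<alpha>"
            using sub by (cases "\<alpha> \<in> set_pmf p") (auto simp: enabled_def set_pmf_iff)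
        qed
        also have "\<dots> = 1"
          using sub fin by (intro sum_pmf_eq_1) (auto simp: enabled_def)
        finally have "(\<Sum>x\<in>?C. step_prob M \<SS> s\<^sub>0 n \<omega> x) = 1" .
        moreover have "0 \<le> step_prob M \<SS> s\<^sub>0 n \<omega> x" if "x \<in> ?C" for x
          using that M s by (cases x) (auto simp: eq is_mdp_def split: option.splits)
        ultimately show ?thesis by blast
      qed
    qed
    then show "(\<Sum>x\<in>?C. step_prob M \<SS> s\<^sub>0 n \<omega> x) = 1" "\<forall>x\<in>?C. 0 \<le> step_prob M \<SS> s\<^sub>0 n \<omega> x"
      by blast+
  qed
  have prob: "prob_space (step_kernel M \<SS> s\<^sub>0 n \<omega>)" if "\<omega> \<in> {0..<n} \<rightarrow>\<^sub>E ?C" for n \<omega>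
    using prob_space_point_measure[OF finC, of "step_prob M \<SS> s\<^sub>0 n \<omega>"] sum1[OF that] nonneg[OF that]
    by (simp add: step_kernel_def step_space_def point_measure_def sum_ennreal)
  have PiM: "PiM {0..<n} (\<lambda>_. step_space M) = count_space ({0..<n} \<rightarrow>\<^sub>E ?C)" for n :: nat
    unfolding step_space_def using finC by (intro count_space_PiM_finite) (auto intro: countable_finite)
  show ?thesis
    unfolding Ionescu_Tulcea_def PiM using prob
    by (auto simp: space_subprob_algebra step_kernel_def intro: prob_space_imp_subprob_space)
qed

definition path_until :: "'s set \<Rightarrow> 's set \<Rightarrow> ('s, 'a) run \<Rightarrow> bool" where
  "path_until X T \<omega> \<longleftrightarrow> (\<exists>n. snd (\<omega> n) \<in> T \<and> (\<forall>i<n. snd (\<omega> i) \<in> X))"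

lemma path_measure_well_defined:
  assumes "is_mdp M" "is_scheduler M \<SS>" "s\<^sub>0 \<in> states M"
  shows "prob_space (path_measure M \<SS> s\<^sub>0)"
    and "{\<omega> \<in> space (path_measure M \<SS> s\<^sub>0). path_until X T \<omega>} \<in> sets (path_measure M \<SS> s\<^sub>0)"
proof -
  interpret Ionescu_Tulcea "step_kernel M \<SS> s\<^sub>0" "\<lambda>_. step_space M"
    by (rule Ionescu_Tulcea_step_kernel[OF assms])
  have PM: "path_measure M \<SS> s\<^sub>0 = PF.lim"
    by (simp add: path_measure_def)
  show "prob_space (path_measure M \<SS> s\<^sub>0)"
  proof
    have "emeasure PF.lim (PF.emb UNIV {} (space (PiM {} (\<lambda>_. step_space M)))) =
        emeasure (CI {}) (space (PiM {} (\<lambda>_. step_space M)))"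
      by (rule lim) auto
    also have "\<dots> = 1"
      using prob_space.emeasure_space_1[OF PF.prob_space_P[of "{}"]] by (simp add: CI_def)
    finally show "emeasure (path_measure M \<SS> s\<^sub>0) (space (path_measure M \<SS> s\<^sub>0)) = 1"
      by (simp add: PM PF.space_lim prod_emb_def space_PiM vimage_def restrict_def)
  qed
  have [measurable]: "Measurable.pred (path_measure M \<SS> s\<^sub>0) (\<lambda>\<omega>. snd (\<omega> i) \<in> A)" for i A
  proof -
    have "(\<lambda>\<omega>. \<omega> i) \<in> measurable (PiM UNIV (\<lambda>_. step_space M)) (step_space M)"
      by (rule measurable_component_singleton) simp
    moreover have "Measurable.pred (step_space M) (\<lambda>x. snd x \<in> A)"
      by (simp add: step_space_def)
    ultimately have "Measurable.pred (PiM UNIV (\<lambda>_. step_space M)) (\<lambda>\<omega>. snd (\<omega> i) \<in> A)"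
      by (rule measurable_compose)
    then show ?thesis
      by (simp add: PM measurable_cong_sets[OF PF.sets_lim refl])
  qed
  show "{\<omega> \<in> space (path_measure M \<SS> s\<^sub>0). path_until X T \<omega>} \<in> sets (path_measure M \<SS> s\<^sub>0)"
    unfolding path_until_def by measurable
qed

definition reach :: "('s, 'a) mdp \<Rightarrow> 's set \<Rightarrow> ('s, 'a) run \<Rightarrow> bool" where
  "reach M T = path_until (states M) T"

definition Pr_from :: "('s, 'a) mdp \<Rightarrow> 's \<Rightarrow> ('s, 'a) scheduler \<Rightarrow> (('s, 'a) run \<Rightarrow> bool) \<Rightarrow> real" where
  "Pr_from M s \<SS> \<phi> = \<P>(\<omega> in path_measure M \<SS> s. \<phi> \<omega>)"

definition Pr :: "('s, 'a) mdp \<Rightarrow> ('s, 'a) scheduler \<Rightarrow> (('s, 'a) run \<Rightarrow> bool) \<Rightarrow> real" where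
  "Pr M \<SS> \<phi> = Pr_from M (init M) \<SS> \<phi>"

definition Pr_cond ::
  "('s, 'a) mdp \<Rightarrow> ('s, 'a) scheduler \<Rightarrow> (('s, 'a) run \<Rightarrow> bool) \<Rightarrow> (('s, 'a) run \<Rightarrow> bool) \<Rightarrow> real" where
  "Pr_cond M \<SS> \<phi> \<psi> = cond_prob (path_measure M \<SS> (init M)) \<phi> \<psi>"

definition Pr_min :: "('s, 'a) mdp \<Rightarrow> 's \<Rightarrow> (('s, 'a) run \<Rightarrow> bool) \<Rightarrow> real" where
  "Pr_min M s \<phi> = (INF \<SS>\<in>{\<SS>. is_scheduler M \<SS>}. Pr_from M s \<SS> \<phi>)"

definition cond_M :: "('s, 'a) mdp \<Rightarrow> 's set \<Rightarrow> bool" where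
  "cond_M M Cause \<longleftrightarrow>
     (\<forall>c\<in>Cause. \<exists>\<SS>. is_scheduler M \<SS> \<and> Pr M \<SS> (path_until (states M - Cause) {c}) > 0)"

definition cond_G :: "('s, 'a) mdp \<Rightarrow> 's set \<Rightarrow> 's set \<Rightarrow> bool" where
  "cond_G M Cause Eff \<longleftrightarrow>
     (\<forall>\<SS>. is_scheduler M \<SS> \<and> Pr M \<SS> (reach M Cause) > 0 \<longrightarrow>
        Pr_cond M \<SS> (reach M Eff) (reach M Cause) > Pr M \<SS> (reach M Eff))"

definition GPR_cause :: "('s, 'a) mdp \<Rightarrow> 's set \<Rightarrow> 's set \<Rightarrow> bool" where
  "GPR_cause M Cause Eff \<longleftrightarrow> cond_G M Cause Eff \<and> cond_M M Cause"

text \<open>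
  States and actions of \<open>M\<close> are embedded by \<open>Some\<close>; the new action \<open>\<gamma>\<close> is \<open>None\<close>. The state
  \<open>noeff\<close> is either fresh, \<open>noeff = None\<close>, or an original state, \<open>noeff = Some t\<close> with \<open>t \<in> states M\<close>.
\<close>

definition min_mdp ::
  "('s, 'a) mdp \<Rightarrow> 's set \<Rightarrow> 's set \<Rightarrow> 's \<Rightarrow> 's option \<Rightarrow> ('s option, 'a option) mdp" where
  "min_mdp M C Eff eff noeff =
     \<lparr> states = insert noeff (Some ` states M),
       acts = insert None (Some ` acts M),
       trans_prob = (\<lambda>s \<alpha> t. case (s, \<alpha>) of
           (Some u, Some a) \<Rightarrow>
             (if u \<in> C then 0 else (case t of Some v \<Rightarrow> trans_prob M u a v | None \<Rightarrow> 0))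
         | (Some u, None) \<Rightarrow>
             (if u \<notin> C then 0
              else if t = Some eff then Pr_min M u (reach M Eff)
              else if t = noeff then 1 - Pr_min M u (reach M Eff)
              else 0)
         | (None, _) \<Rightarrow> 0),
       init = Some (init M) \<rparr>"

end

theory Submission
  imports Defs
begin

text \<open>
  Only the behaviour before \<open>Cause\<close> matters: after reaching \<open>Cause\<close> we may minimise the probability of
  \<open>Eff\<close>. With \<open>p\<close>, \<open>q\<close>, \<open>e\<close> the probabilities of reaching \<open>Cause\<close>, of reaching \<open>Eff\<close> after \<open>Cause\<close>
  in the minimised continuation, and of reaching \<open>Eff\<close> without \<open>Cause\<close>, a violation of (G) becomes
  \<open>f(p, q, e) = q - p (q + e) \<le> 0\<close> with \<open>p > 0\<close>. The vectors of all schedulers lie in the convex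
  hull of the vectors of the finitely many deterministic memoryless policies, because linear rewards
  are optimised by such policies. Let \<open>v\<close> be a minimiser of \<open>f\<close> on this hull, with \<open>p > 0\<close>, and \<open>g\<close> the
  linear reward given by the gradient of \<open>f\<close> at \<open>v\<close>. All policies mixed in \<open>v\<close> are \<open>g\<close>-optimal.
  A memoryless scheduler cannot in general realise \<open>v\<close>, since it cannot remain in an end component
  with a probability strictly between 0 and 1. But let \<open>Z\<close> be the set of states from which targets
  can be avoided surely and the optimal \<open>g\<close>-value is 0. Giving up as soon as \<open>Z\<close> is entered removes from
  \<open>v\<close> a nonnegative part that is \<open>g\<close>-neutral, and in nonnegative directions \<open>f\<close> is concave, so
  \<open>f\<close> does not increase. Outside \<open>Z\<close> the policies lose no mass, hence have finite
  occupation measures, and normalising the mixed occupation measure yields the memoryless scheduler.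
\<close>

section \<open>Expected rewards of schedulers\<close>

text \<open>Constrains the choices only inside \<open>G\<close>, so that one scheduler can be
  stopped at several sets and modified once \<open>G\<close> is left.\<close>

definition valid :: "('s, 'a) mdp \<Rightarrow> 's set \<Rightarrow> ('s, 'a) scheduler \<Rightarrow> bool" where
  "valid M G S \<longleftrightarrow> (\<forall>h. \<forall>s\<in>G. set_pmf (S h s) \<subseteq> enabled M s)"

definition step_exp ::
  "('s, 'a) mdp \<Rightarrow> ('s, 'a) scheduler \<Rightarrow> (('s \<times> 'a) list \<Rightarrow> 's \<Rightarrow> real) \<Rightarrow> ('s \<times> 'a) list \<Rightarrow> 's \<Rightarrow> real" where
  "step_exp M S \<phi> h s =
     (\<Sum>a\<in>acts M. pmf (S h s) a * (\<Sum>t\<in>states M. trans_prob M s a t * \<phi> (h @ [(s, a)]) t))"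

text \<open>
  \<open>g\<close> is collected once, in the state where \<open>G\<close> is left (at once when starting outside \<open>G\<close>), and
  \<open>gain n\<close> is the expectation of the part collected after exactly \<open>n\<close> steps. Runs that stay in
  \<open>G\<close> forever earn nothing.
\<close>

primrec gain ::
  "('s, 'a) mdp \<Rightarrow> ('s, 'a) scheduler \<Rightarrow> 's set \<Rightarrow> ('s \<Rightarrow> real) \<Rightarrow> nat \<Rightarrow> ('s \<times> 'a) list \<Rightarrow> 's \<Rightarrow> real" where
  "gain M S G g 0 = (\<lambda>h s. if s \<in> G then 0 else g s)"
| "gain M S G g (Suc n) = (\<lambda>h s. if s \<in> G then step_exp M S (gain M S G g n) h s else 0)"

text \<open>\<open>b = 1\<close> gives the expected reward itself; \<open>b < 1\<close> discounts
  every step before the stop and makes the Bellman operator a contraction in the search for optimal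
  policies.\<close>

definition reward ::
  "real \<Rightarrow> ('s, 'a) mdp \<Rightarrow> ('s, 'a) scheduler \<Rightarrow> 's set \<Rightarrow> ('s \<Rightarrow> real) \<Rightarrow> ('s \<times> 'a) list \<Rightarrow> 's \<Rightarrow> real" where
  "reward b M S G g h s = (\<Sum>n. b ^ n * gain M S G g n h s)"

definition policy :: "('s \<Rightarrow> 'a pmf) \<Rightarrow> ('s, 'a) scheduler" where
  "policy \<delta> = (\<lambda>h s. \<delta> s)"

lemma step_exp_add:
  "step_exp M S (\<lambda>h s. \<phi> h s + \<psi> h s) h s = step_exp M S \<phi> h s + step_exp M S \<psi> h s"
  by (simp add: step_exp_def algebra_simps sum.distrib)

lemma step_exp_cmult: "step_exp M S (\<lambda>h s. c * \<phi> h s) h s = c * step_exp M S \<phi> h s"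
  by (simp add: step_exp_def sum_distrib_left mult_ac)

lemma step_exp_sum:
  "step_exp M S (\<lambda>h s. \<Sum>i\<in>I. \<phi> i h s) h s = (\<Sum>i\<in>I. step_exp M S (\<phi> i) h s)"
  unfolding step_exp_def
  by (simp add: sum_distrib_left sum.swap[of _ _ I])

lemma step_exp_cong:
  assumes "S h s = S' h' s"
    and "\<And>a t. a \<in> acts M \<Longrightarrow> t \<in> states M \<Longrightarrow> \<phi> (h @ [(s, a)]) t = \<psi> (h' @ [(s, a)]) t"
  shows "step_exp M S \<phi> h s = step_exp M S' \<psi> h' s"
  unfolding step_exp_def using assms by (auto intro!: sum.cong)

text \<open>\<open>J\<close> is an invariant linking a history of one run to a history of the other:
  the schedulers have to agree only on linked histories. This covers residual schedulers, memoryless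
  ones, and those that switch behaviour at some point.\<close>

lemma gain_cong:
  assumes "J h h' s"
    and "\<And>h h' s. J h h' s \<Longrightarrow> s \<in> G \<Longrightarrow> S h s = S' h' s"
    and "\<And>h h' s a t. J h h' s \<Longrightarrow> s \<in> G \<Longrightarrow> J (h @ [(s, a)]) (h' @ [(s, a)]) t"
  shows "gain M S G g n h s = gain M S' G g n h' s"
  using assms(1)
proof (induction n arbitrary: h h' s)
  case (Suc n)
  then show ?case using assms(2,3) by (auto intro!: step_exp_cong)
qed simp

lemma reward_cong:
  assumes "J h h' s"
    and "\<And>h h' s. J h h' s \<Longrightarrow> s \<in> G \<Longrightarrow> S h s = S' h' s"
    and "\<And>h h' s a t. J h h' s \<Longrightarrow> s \<in> G \<Longrightarrow> J (h @ [(s, a)]) (h' @ [(s, a)]) t"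
  shows "reward b M S G g h s = reward b M S' G g h' s"
  unfolding reward_def using gain_cong[of J, OF assms] by simp

lemma reward_shift: "reward b M (\<lambda>k. S (h @ k)) G g k s = reward b M S G g (h @ k) s"
  by (rule reward_cong[where J = "\<lambda>k' h' s. h' = h @ k'"]) auto

lemma reward_policy: "reward b M (policy \<delta>) G g h s = reward b M (policy \<delta>) G g [] s"
  by (rule reward_cong[where J = "\<lambda>_ _ _. True"]) (auto simp: policy_def)

lemma gain_cong_reward:
  assumes "\<And>s. s \<in> states M \<Longrightarrow> s \<notin> G \<Longrightarrow> g s = g' s" "s \<in> states M"
  shows "gain M S G g n h s = gain M S G g' n h s"
  using assms(2)
  by (induction n arbitrary: h s) (auto simp: assms(1) intro!: step_exp_cong)

lemma gain_add:
  "gain M S G (\<lambda>s. g s + g' s) n h s = gain M S G g n h s + gain M S G g' n h s"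
proof (induction n arbitrary: h s)
  case (Suc n)
  then have "gain M S G (\<lambda>s. g s + g' s) n = (\<lambda>h s. gain M S G g n h s + gain M S G g' n h s)"
    by (intro ext)
  then show ?case by (simp add: step_exp_add)
qed simp

lemma gain_cmult: "gain M S G (\<lambda>s. c * g s) n h s = c * gain M S G g n h s"
proof (induction n arbitrary: h s)
  case (Suc n)
  then have "gain M S G (\<lambda>s. c * g s) n = (\<lambda>h s. c * gain M S G g n h s)"
    by (intro ext)
  then show ?case by (simp add: step_exp_cmult)
qed simp

lemma sum_gain_Suc:
  "(\<Sum>k\<le>Suc n. gain M S G g k h s) =
     (if s \<in> G then step_exp M S (\<lambda>h s. \<Sum>k\<le>n. gain M S G g k h s) h s else g s)"
  by (subst sum.atMost_Suc_shift) (simp add: step_exp_sum)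

locale stopped_mdp =
  fixes M :: "('s, 'a) mdp" and G :: "'s set"
  assumes mdp: "is_mdp M"
    and G_states: "G \<subseteq> states M"
    and G_nonterminal: "s \<in> G \<Longrightarrow> \<not> terminal M s"
begin

lemma finite_states: "finite (states M)" and finite_acts: "finite (acts M)"
  using mdp by (auto simp: is_mdp_def)

lemma finite_G: "finite G"
  using finite_subset[OF G_states finite_states] .

lemma trans_nonneg: "s \<in> states M \<Longrightarrow> a \<in> acts M \<Longrightarrow> t \<in> states M \<Longrightarrow> 0 \<le> trans_prob M s a t"
  using mdp by (auto simp: is_mdp_def)

lemma enabled_acts: "a \<in> enabled M s \<Longrightarrow> a \<in> acts M"
  by (simp add: enabled_def)

lemma trans_sum: "a \<in> enabled M s \<Longrightarrow> (\<Sum>t\<in>states M. trans_prob M s a t) = 1"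
  by (simp add: enabled_def)

lemma enabled_nonempty: "s \<in> G \<Longrightarrow> enabled M s \<noteq> {}"
  using G_nonterminal by (auto simp: terminal_def)

lemma valid_subset: "valid M G S \<Longrightarrow> s \<in> G \<Longrightarrow> set_pmf (S h s) \<subseteq> enabled M s"
  by (auto simp: valid_def)

lemma valid_shift: "valid M G S \<Longrightarrow> valid M G (\<lambda>k. S (h @ k))"
  by (auto simp: valid_def)

lemma pmf_sum: "valid M G S \<Longrightarrow> s \<in> G \<Longrightarrow> (\<Sum>a\<in>acts M. pmf (S h s) a) = 1"
  using valid_subset enabled_acts finite_acts by (intro sum_pmf_eq_1) blast+

lemma step_exp_enabled:
  assumes "valid M G S" "s \<in> G"
  shows "step_exp M S \<phi> h s =
     (\<Sum>a\<in>enabled M s. pmf (S h s) a * (\<Sum>t\<in>states M. trans_prob M s a t * \<phi> (h @ [(s, a)]) t))"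
  unfolding step_exp_def
proof (rule sum.mono_neutral_right)
  show "\<forall>i\<in>acts M - enabled M s.
       pmf (S h s) i * (\<Sum>t\<in>states M. trans_prob M s i t * \<phi> (h @ [(s, i)]) t) = 0"
    using valid_subset[OF assms, of h] by (auto simp: pmf_eq_0_set_pmf)
qed (auto simp: finite_acts enabled_acts)

lemma step_exp_mono:
  assumes "valid M G S" "s \<in> G"
    and "\<And>a t. a \<in> enabled M s \<Longrightarrow> t \<in> states M \<Longrightarrow> \<phi> (h @ [(s, a)]) t \<le> \<psi> (h @ [(s, a)]) t"
  shows "step_exp M S \<phi> h s \<le> step_exp M S \<psi> h s"
  unfolding step_exp_enabled[OF assms(1,2)]
proof (intro sum_mono mult_left_mono)
  fix a t assume "a \<in> enabled M s" "t \<in> states M"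
  then show "\<phi> (h @ [(s, a)]) t \<le> \<psi> (h @ [(s, a)]) t" by (rule assms(3))
qed (use assms(2) G_states trans_nonneg enabled_acts in auto)

lemma step_exp_const:
  assumes "valid M G S" "s \<in> G"
  shows "step_exp M S (\<lambda>_ _. c) h s = c"
proof -
  have "step_exp M S (\<lambda>_ _. c) h s = (\<Sum>a\<in>enabled M s. pmf (S h s) a * c)"
    unfolding step_exp_enabled[OF assms]
    by (intro sum.cong refl) (simp add: sum_distrib_right[symmetric] trans_sum)
  also have "\<dots> = (\<Sum>a\<in>acts M. pmf (S h s) a * c)"
    using valid_subset[OF assms, of h]
    by (intro sum.mono_neutral_left) (auto simp: finite_acts enabled_acts pmf_eq_0_set_pmf)
  also have "\<dots> = c"
    by (simp add: sum_distrib_right[symmetric] pmf_sum[OF assms])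
  finally show ?thesis .
qed

lemma gain_nonneg:
  assumes "valid M G S" "\<And>s. s \<in> states M \<Longrightarrow> 0 \<le> g s" "s \<in> states M"
  shows "0 \<le> gain M S G g n h s"
  using assms(3)
proof (induction n arbitrary: h s)
  case (Suc n)
  then have "s \<in> G \<Longrightarrow> step_exp M S (\<lambda>_ _. 0) h s \<le> step_exp M S (gain M S G g n) h s"
    by (intro step_exp_mono[OF assms(1)]) auto
  then show ?case by (simp add: step_exp_const[OF assms(1)])
qed (simp add: assms(2))

lemma gain_mono:
  assumes "valid M G S" "\<And>s. s \<in> states M \<Longrightarrow> g s \<le> g' s" "s \<in> states M"
  shows "gain M S G g n h s \<le> gain M S G g' n h s"
proof -
  have "gain M S G (\<lambda>s. g s + (g' s - g s)) n h s \<ge> gain M S G g n h s"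
    unfolding gain_add using gain_nonneg[OF assms(1), of "\<lambda>s. g' s - g s"] assms(2,3) by simp
  then show ?thesis by simp
qed

lemma abs_gain_le:
  assumes "valid M G S" "s \<in> states M"
  shows "\<bar>gain M S G g n h s\<bar> \<le> gain M S G (\<lambda>s. \<bar>g s\<bar>) n h s"
proof -
  have "gain M S G g n h s \<le> gain M S G (\<lambda>s. \<bar>g s\<bar>) n h s"
    by (rule gain_mono[OF assms(1) _ assms(2)]) simp
  moreover have "gain M S G (\<lambda>s. -1 * g s) n h s \<le> gain M S G (\<lambda>s. \<bar>g s\<bar>) n h s"
    by (rule gain_mono[OF assms(1) _ assms(2)]) simp
  ultimately show ?thesis unfolding gain_cmult by linarith
qed

text \<open>Induction on the horizon. Runs still inside \<open>G\<close> have earned 0, which is why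
  \<open>c\<close> is nonnegative.\<close>

lemma sum_gain_le:
  assumes "valid M G S" "0 \<le> c" "\<And>s. s \<in> states M \<Longrightarrow> s \<notin> G \<Longrightarrow> g s \<le> c" "s \<in> states M"
  shows "(\<Sum>k\<le>n. gain M S G g k h s) \<le> c"
  using assms(4)
proof (induction n arbitrary: h s)
  case (Suc n)
  show ?case
  proof (cases "s \<in> G")
    case True
    then have "step_exp M S (\<lambda>h s. \<Sum>k\<le>n. gain M S G g k h s) h s \<le> step_exp M S (\<lambda>_ _. c) h s"
      using Suc by (intro step_exp_mono[OF assms(1)]) auto
    then show ?thesis unfolding sum_gain_Suc using True by (simp add: step_exp_const[OF assms(1)])
  qed (use Suc assms in \<open>simp add: sum_gain_Suc del: sum.atMost_Suc\<close>)
qed (use assms in auto)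

text \<open>The gains of the absolute value of \<open>g\<close> dominate, and their partial sums are
  bounded by its total over the finite state space.\<close>

lemma summable_abs_gain:
  assumes "valid M G S" "s \<in> states M"
  shows "summable (\<lambda>n. \<bar>gain M S G g n h s\<bar>)"
proof (rule summable_comparison_test'[where N = 0])
  have "\<bar>g s\<bar> \<le> (\<Sum>s\<in>states M. \<bar>g s\<bar>)" if "s \<in> states M" for s
    using that finite_states by (intro member_le_sum) auto
  then have "(\<Sum>k\<le>n. gain M S G (\<lambda>s. \<bar>g s\<bar>) k h s) \<le> (\<Sum>s\<in>states M. \<bar>g s\<bar>)" for n
    by (intro sum_gain_le[OF assms(1)] sum_nonneg assms(2)) auto
  moreover have "{..<n} \<subseteq> {..n}" for n :: nat by auto
  ultimately show "summable (\<lambda>n. gain M S G (\<lambda>s. \<bar>g s\<bar>) n h s)"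
    by (intro bounded_imp_summable[where B = "\<Sum>s\<in>states M. \<bar>g s\<bar>"])
       (auto intro!: gain_nonneg[OF assms(1) _ assms(2)])
qed (use abs_gain_le[OF assms] in simp)

lemma summable_reward:
  assumes "valid M G S" "s \<in> states M" "0 \<le> b" "b \<le> 1"
  shows "summable (\<lambda>n. b ^ n * gain M S G g n h s)"
proof (rule summable_comparison_test'[OF summable_abs_gain[OF assms(1,2)], of 0])
  show "norm (b ^ n * gain M S G g n h s) \<le> \<bar>gain M S G g n h s\<bar>" for n
    using assms(3,4) by (simp add: abs_mult power_le_one mult_left_le_one_le)
qed

lemma reward_outside: "s \<notin> G \<Longrightarrow> reward b M S G g h s = g s"
proof -
  assume s: "s \<notin> G"
  have "(\<lambda>n. b ^ n * gain M S G g n h s) = (\<lambda>n. if n = 0 then g s else 0)"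
  proof
    fix n show "b ^ n * gain M S G g n h s = (if n = 0 then g s else 0)" using s by (cases n) auto
  qed
  moreover have "(\<lambda>n. if n = 0 then g s else 0) sums g s"
    using sums_single[of 0 "\<lambda>_. g s"] .
  ultimately show ?thesis by (simp add: reward_def sums_iff)
qed

text \<open>Bellman equation: the recursion of \<open>gain\<close> summed over the step number,
  where summability permits exchanging the series with the finite expectation.\<close>

lemma reward_step:
  assumes "valid M G S" "s \<in> G" "0 \<le> b" "b \<le> 1"
  shows "reward b M S G g h s = b * step_exp M S (reward b M S G g) h s"
proof -
  let ?e = "gain M S G g"
  have sG: "s \<in> states M" using assms G_states by auto
  have "(\<lambda>n. b * (\<Sum>a\<in>acts M. pmf (S h s) a *
          (\<Sum>t\<in>states M. trans_prob M s a t * (b ^ n * ?e n (h @ [(s, a)]) t))))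
        sums (b * step_exp M S (reward b M S G g) h s)"
    unfolding step_exp_def reward_def
    by (intro sums_mult sums_sum summable_sums summable_reward assms)
  moreover have "b * (\<Sum>a\<in>acts M. pmf (S h s) a *
          (\<Sum>t\<in>states M. trans_prob M s a t * (b ^ n * ?e n (h @ [(s, a)]) t)))
        = b ^ Suc n * ?e (Suc n) h s" for n
    using assms(2) by (simp add: step_exp_def sum_distrib_left mult_ac)
  ultimately have "(\<lambda>n. b ^ Suc n * ?e (Suc n) h s) sums (b * step_exp M S (reward b M S G g) h s)"
    by simp
  moreover have "reward b M S G g h s = (\<Sum>n. b ^ Suc n * ?e (Suc n) h s)"
    using suminf_split_head[OF summable_reward[OF assms(1) sG assms(3,4)], of g h] assms(2)
    by (simp add: reward_def)
  ultimately show ?thesis by (simp add: sums_iff)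
qed

lemma reward_add:
  assumes "valid M G S" "s \<in> states M" "0 \<le> b" "b \<le> 1"
  shows "reward b M S G (\<lambda>s. g s + g' s) h s = reward b M S G g h s + reward b M S G g' h s"
  unfolding reward_def gain_add
  using suminf_add[OF summable_reward[OF assms] summable_reward[OF assms]]
  by (simp add: algebra_simps)

lemma reward_cmult:
  assumes "valid M G S" "s \<in> states M" "0 \<le> b" "b \<le> 1"
  shows "reward b M S G (\<lambda>s. c * g s) h s = c * reward b M S G g h s"
  unfolding reward_def gain_cmult
  using suminf_mult[OF summable_reward[OF assms]] by (simp add: mult.left_commute)

lemma reward_cong_reward:
  assumes "\<And>s. s \<in> states M \<Longrightarrow> s \<notin> G \<Longrightarrow> g s = g' s" "s \<in> states M"
  shows "reward b M S G g h s = reward b M S G g' h s"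
  unfolding reward_def using gain_cong_reward[OF assms] by simp

lemma reward_nonneg:
  assumes "valid M G S" "\<And>s. s \<in> states M \<Longrightarrow> s \<notin> G \<Longrightarrow> 0 \<le> g s" "s \<in> states M" "0 \<le> b" "b \<le> 1"
  shows "0 \<le> reward b M S G g h s"
proof -
  have "0 \<le> reward b M S G (\<lambda>s. if s \<in> G then 0 else g s) h s"
    unfolding reward_def using assms
    by (intro suminf_nonneg summable_reward mult_nonneg_nonneg gain_nonneg) auto
  also have "\<dots> = reward b M S G g h s" by (rule reward_cong_reward) (use assms in auto)
  finally show ?thesis .
qed

lemma reward_mono:
  assumes "valid M G S" "\<And>s. s \<in> states M \<Longrightarrow> s \<notin> G \<Longrightarrow> g s \<le> g' s" "s \<in> states M" "0 \<le> b" "b \<le> 1"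
  shows "reward b M S G g h s \<le> reward b M S G g' h s"
proof -
  have "0 \<le> reward b M S G (\<lambda>s. g' s + (-1) * g s) h s"
    using assms by (intro reward_nonneg) auto
  also have "\<dots> = reward b M S G g' h s - reward b M S G g h s"
    by (subst reward_add[OF assms(1,3-5)], subst reward_cmult[OF assms(1,3-5)]) simp
  finally show ?thesis by simp
qed

lemma reward_sums: 
  assumes "valid M G S" "s \<in> states M"
  shows "(\<lambda>n. \<Sum>k\<le>n. gain M S G g k h s) \<longlonglongrightarrow> reward 1 M S G g h s"
proof -
  have "(\<lambda>n. gain M S G g n h s) sums reward 1 M S G g h s"
    unfolding reward_def using summable_reward[OF assms, of 1 g h] by (simp add: summable_sums)
  then show ?thesis by (simp add: sums_def_le)
qed

lemma reward_least:
  assumes "valid M G S"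
    and "\<And>h s. s \<in> states M \<Longrightarrow> 0 \<le> \<phi> h s"
    and "\<And>h s. s \<in> states M \<Longrightarrow> s \<notin> G \<Longrightarrow> g s \<le> \<phi> h s"
    and "\<And>h s. s \<in> G \<Longrightarrow> step_exp M S \<phi> h s \<le> \<phi> h s"
    and "s \<in> states M"
  shows "reward 1 M S G g h s \<le> \<phi> h s"
proof (rule LIMSEQ_le_const2[OF reward_sums[OF assms(1,5)]], intro exI allI impI)
  fix n :: nat
  show "(\<Sum>k\<le>n. gain M S G g k h s) \<le> \<phi> h s"
    using assms(5)
  proof (induction n arbitrary: h s)
    case (Suc n)
    show ?case
    proof (cases "s \<in> G")
      case True
      then have "step_exp M S (\<lambda>h s. \<Sum>k\<le>n. gain M S G g k h s) h s \<le> step_exp M S \<phi> h s"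
        using Suc by (intro step_exp_mono[OF assms(1)]) auto
      also have "\<dots> \<le> \<phi> h s" using assms(4) True .
      finally show ?thesis unfolding sum_gain_Suc using True by simp
    qed (use Suc assms in \<open>simp add: sum_gain_Suc del: sum.atMost_Suc\<close>)
  qed (use assms in auto)
qed

lemma reward_le:
  assumes "valid M G S" "0 \<le> c" "\<And>s. s \<in> states M \<Longrightarrow> s \<notin> G \<Longrightarrow> g s \<le> c" "s \<in> states M"
  shows "reward 1 M S G g h s \<le> c"
  by (rule reward_least[where \<phi> = "\<lambda>_ _. c", OF assms(1)]) (use assms step_exp_const in auto)

end

section \<open>Optimal deterministic policies\<close>

definition md :: "('s \<Rightarrow> 'a) \<Rightarrow> ('s, 'a) scheduler" where
  "md d = policy (\<lambda>s. return_pmf (d s))"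

context stopped_mdp
begin

lemma valid_md: "(\<And>s. s \<in> G \<Longrightarrow> d s \<in> enabled M s) \<Longrightarrow> valid M G (md d)"
  by (simp add: valid_def md_def policy_def)

lemma valid_exists: "\<exists>S. valid M G S"
  using valid_md[of "\<lambda>s. SOME a. a \<in> enabled M s"] enabled_nonempty by (auto simp: some_in_eq)

lemma step_exp_return:
  assumes "S h s = return_pmf a" "a \<in> acts M"
  shows "step_exp M S \<phi> h s = (\<Sum>t\<in>states M. trans_prob M s a t * \<phi> (h @ [(s, a)]) t)"
proof -
  have "step_exp M S \<phi> h s = (\<Sum>a'\<in>acts M. if a' = a
      then (\<Sum>t\<in>states M. trans_prob M s a t * \<phi> (h @ [(s, a)]) t) else 0)"
    unfolding step_exp_def assms(1) by (intro sum.cong) (auto simp: indicator_def)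
  then show ?thesis using finite_acts assms(2) by simp
qed

lemma reward_md_step:
  assumes "\<And>s. s \<in> G \<Longrightarrow> d s \<in> enabled M s" "s \<in> G" "0 \<le> b" "b \<le> 1"
  shows "reward b M (md d) G g h s =
     b * (\<Sum>t\<in>states M. trans_prob M s (d s) t * reward b M (md d) G g [] t)"
proof -
  have "step_exp M (md d) (reward b M (md d) G g) h s =
      (\<Sum>t\<in>states M. trans_prob M s (d s) t * reward b M (md d) G g (h @ [(s, d s)]) t)"
    using assms(1,2) enabled_acts by (intro step_exp_return) (auto simp: md_def policy_def)
  then show ?thesis
    using reward_step[OF valid_md[OF assms(1)] assms(2-4), of g h]
    unfolding md_def by (simp add: reward_policy[of _ _ _ _ _ "_ @ _"])
qed

lemma abs_reward_le:
  assumes "valid M G S" "s \<in> states M" "0 \<le> b" "b \<le> 1"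
  shows "\<bar>reward b M S G g h s\<bar> \<le> (\<Sum>s\<in>states M. \<bar>g s\<bar>)"
proof -
  have le: "norm (b ^ n * gain M S G g n h s) \<le> gain M S G (\<lambda>s. \<bar>g s\<bar>) n h s" for n
    using order_trans[OF mult_left_le_one_le abs_gain_le[OF assms(1,2)]] assms(3,4)
    by (simp add: abs_mult power_le_one)
  have sm: "summable (\<lambda>n. gain M S G (\<lambda>s. \<bar>g s\<bar>) n h s)"
    using summable_reward[OF assms(1,2), of 1] by simp
  then have sn: "summable (\<lambda>n. norm (b ^ n * gain M S G g n h s))"
    by (rule summable_comparison_test') (use le in simp)
  have "\<bar>reward b M S G g h s\<bar> \<le> (\<Sum>n. norm (b ^ n * gain M S G g n h s))"
    unfolding reward_def using summable_norm[OF sn] by simp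
  also have "\<dots> \<le> (\<Sum>n. gain M S G (\<lambda>s. \<bar>g s\<bar>) n h s)"
    by (intro suminf_le le sn sm)
  also have "\<dots> = reward 1 M S G (\<lambda>s. \<bar>g s\<bar>) h s" by (simp add: reward_def)
  also have "\<dots> \<le> (\<Sum>s\<in>states M. \<bar>g s\<bar>)"
  proof (rule reward_le[OF assms(1) _ _ assms(2)])
    show "\<bar>g s\<bar> \<le> (\<Sum>s\<in>states M. \<bar>g s\<bar>)" if "s \<in> states M" for s
      using that finite_states by (intro member_le_sum) auto
  qed (simp add: sum_nonneg)
  finally show ?thesis .
qed

text \<open>\<open>U\<close> is the optimal value over all history-dependent schedulers, and
  \<open>d\<close> picks an action minimising its one-step expectation. The value \<open>V\<close>
  of \<open>d\<close> does not exceed \<open>U\<close>: at a state of \<open>G\<close> minimising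
  \<open>U - V\<close> this difference is at least \<open>b\<close> times itself, hence nonnegative
  as \<open>b < 1\<close>.\<close>

lemma discounted_optimal_policy:
  assumes b: "0 \<le> b" "b < 1"
  shows "\<exists>d\<in>(\<Pi>\<^sub>E s\<in>G. enabled M s). \<forall>S s. valid M G S \<longrightarrow> s \<in> states M \<longrightarrow>
           reward b M (md d) G g [] s \<le> reward b M S G g [] s"
proof -
  define U where "U s = (INF S\<in>{S. valid M G S}. reward b M S G g [] s)" for s
  define q where "q s a = (\<Sum>t\<in>states M. trans_prob M s a t * U t)" for s a
  define d where "d = (\<lambda>s\<in>G. arg_min_on (q s) (enabled M s))"
  have fe: "finite (enabled M s)" for s using finite_acts by (simp add: enabled_def)
  have d: "d s \<in> enabled M s" and q_le: "a \<in> enabled M s \<Longrightarrow> q s (d s) \<le> q s a" if "s \<in> G" for s a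
    using arg_min_if_finite[OF fe[of s] enabled_nonempty[OF that], of "q s"] that
    by (auto simp: d_def not_less)
  have U_le: "U s \<le> reward b M S G g [] s" if "valid M G S" "s \<in> states M" for S s
    unfolding U_def
  proof (rule cINF_lower)
    show "bdd_below ((\<lambda>S. reward b M S G g [] s) ` {S. valid M G S})"
    proof (rule bdd_belowI2)
      fix S assume "S \<in> {S. valid M G S}"
      then show "- (\<Sum>s\<in>states M. \<bar>g s\<bar>) \<le> reward b M S G g [] s"
        using abs_reward_le[OF _ that(2), of S b g "[]"] b by (auto simp: abs_le_iff)
    qed
  qed (use that in simp)
  define V where "V s = reward b M (md d) G g [] s" for s
  have V_step: "V s = b * (\<Sum>t\<in>states M. trans_prob M s (d s) t * V t)" if "s \<in> G" for s
    unfolding V_def using reward_md_step[OF d that] b by simp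
  \<comment> \<open>Half of the Bellman equation: after its first step a valid scheduler continues
    as a shifted valid scheduler, whose reward is at least \<open>U\<close>.\<close>
  have U_step: "b * q s (d s) \<le> U s" if s: "s \<in> G" for s
    unfolding U_def
  proof (rule cINF_greatest)
    fix S assume "S \<in> {S. valid M G S}"
    then have S: "valid M G S" by simp
    have "q s (d s) = step_exp M S (\<lambda>_ _. q s (d s)) [] s"
      using step_exp_const[OF S s] by simp
    also have "\<dots> \<le> step_exp M S (\<lambda>_. U) [] s"
      unfolding step_exp_enabled[OF S s]
    proof (rule sum_mono)
      fix a assume a: "a \<in> enabled M s"
      have "(\<Sum>t\<in>states M. trans_prob M s a t * q s (d s)) \<le> (\<Sum>t\<in>states M. trans_prob M s a t * U t)"
        using q_le[OF s a] trans_sum[OF a] by (simp add: sum_distrib_right[symmetric] q_def)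
      then show "pmf (S [] s) a * (\<Sum>t\<in>states M. trans_prob M s a t * q s (d s))
          \<le> pmf (S [] s) a * (\<Sum>t\<in>states M. trans_prob M s a t * U t)"
        by (intro mult_left_mono) auto
    qed
    also have "\<dots> \<le> step_exp M S (reward b M S G g) [] s"
    proof (rule step_exp_mono[OF S s])
      fix a t assume "t \<in> states M"
      then show "U t \<le> reward b M S G g ([] @ [(s, a)]) t"
        using U_le[OF valid_shift[OF S, of "[(s, a)]"], of t] reward_shift[of b M S "[(s, a)]" G g "[]"]
        by simp
    qed
    finally show "b * q s (d s) \<le> reward b M S G g [] s"
      using reward_step[OF S s] b by (simp add: mult_left_mono)
  qed (use valid_exists in auto)
  have VU: "V s \<le> U s" if s: "s \<in> states M" for s
  proof -
    define s0 where "s0 = arg_min_on (\<lambda>s. U s - V s) (states M)"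
    have s0: "s0 \<in> states M" and min: "\<And>s. s \<in> states M \<Longrightarrow> U s0 - V s0 \<le> U s - V s"
      using arg_min_if_finite[OF finite_states, of "\<lambda>s. U s - V s"] s by (auto simp: s0_def not_less)
    have "0 \<le> U s0 - V s0"
    proof (cases "s0 \<in> G")
      case True
      have "U s0 - V s0 = (\<Sum>t\<in>states M. trans_prob M s0 (d s0) t * (U s0 - V s0))"
        using trans_sum[OF d[OF True]] by (simp add: sum_distrib_right[symmetric])
      also have "\<dots> \<le> (\<Sum>t\<in>states M. trans_prob M s0 (d s0) t * (U t - V t))"
        using trans_nonneg[OF s0 enabled_acts[OF d[OF True]]] min by (intro sum_mono mult_left_mono) auto
      also have "\<dots> = q s0 (d s0) - (\<Sum>t\<in>states M. trans_prob M s0 (d s0) t * V t)"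
        by (simp add: q_def sum_subtractf right_diff_distrib)
      finally have "b * (U s0 - V s0) \<le> b * (q s0 (d s0) - (\<Sum>t\<in>states M. trans_prob M s0 (d s0) t * V t))"
        using b by (intro mult_left_mono) auto
      then have "b * (U s0 - V s0) \<le> U s0 - V s0"
        using U_step[OF True] V_step[OF True] by (simp add: right_diff_distrib)
      then have "0 \<le> (1 - b) * (U s0 - V s0)" by (simp add: left_diff_distrib)
      then show ?thesis using b by (simp add: zero_le_mult_iff)
    next
      case False
      have "U s0 = g s0"
        unfolding U_def using valid_exists by (simp add: reward_outside[OF False])
      then show ?thesis by (simp add: V_def reward_outside[OF False])
    qed
    then show ?thesis using min[OF s] by simp
  qed
  have "d \<in> (\<Pi>\<^sub>E s\<in>G. enabled M s)" using d by (auto simp: d_def)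
  then show ?thesis using VU U_le unfolding V_def by (meson order_trans)
qed

text \<open>An Abel limit by Tannery's theorem, with the summable absolute gains as dominating
  sequence.\<close>

lemma reward_discount_tendsto:
  assumes "valid M G S" "s \<in> states M" "\<And>j. 0 \<le> b j" "\<And>j. b j \<le> 1" "b \<longlonglongrightarrow> 1"
  shows "(\<lambda>j. reward (b j) M S G g h s) \<longlonglongrightarrow> reward 1 M S G g h s"
proof -
  have "((\<lambda>j. \<Sum>n. b j ^ n * gain M S G g n h s) \<longlonglongrightarrow> (\<Sum>n. 1 ^ n * gain M S G g n h s))"
  proof (rule tannerys_theorem[THEN conjunct2, THEN conjunct2])
    show "\<forall>\<^sub>F (n, j) in sequentially \<times>\<^sub>F sequentially.
        norm (b j ^ n * gain M S G g n h s) \<le> \<bar>gain M S G g n h s\<bar>"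
    proof (rule always_eventually, clarify)
      fix n j
      show "norm (b j ^ n * gain M S G g n h s) \<le> \<bar>gain M S G g n h s\<bar>"
        using assms(3,4)[of j] by (simp add: abs_mult power_le_one mult_left_le_one_le)
    qed
    show "(\<lambda>j. b j ^ n * gain M S G g n h s) \<longlonglongrightarrow> 1 ^ n * gain M S G g n h s" for n
      by (intro tendsto_intros assms)
  qed (use summable_abs_gain[OF assms(1,2)] in auto)
  then show ?thesis by (simp add: reward_def)
qed

text \<open>Blackwell's argument: one policy is optimal for infinitely many discount factors tending to 1.\<close>

lemma optimal_policy:
  "\<exists>d\<in>(\<Pi>\<^sub>E s\<in>G. enabled M s). \<forall>S s. valid M G S \<longrightarrow> s \<in> states M \<longrightarrow>
     reward 1 M (md d) G g [] s \<le> reward 1 M S G g [] s"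
proof -
  define b :: "nat \<Rightarrow> real" where "b j = 1 - 1 / real (j + 1)" for j
  have b: "0 \<le> b j" "b j < 1" for j by (auto simp: b_def field_simps)
  have lim_b: "b \<longlonglongrightarrow> 1"
    unfolding b_def using tendsto_diff[OF tendsto_const LIMSEQ_inverse_real_of_nat, of 1]
    by (simp add: inverse_eq_divide add.commute)
  have "\<forall>j. \<exists>d. d \<in> (\<Pi>\<^sub>E s\<in>G. enabled M s) \<and> (\<forall>S s. valid M G S \<longrightarrow> s \<in> states M \<longrightarrow>
      reward (b j) M (md d) G g [] s \<le> reward (b j) M S G g [] s)"
    using discounted_optimal_policy[OF b] by blast
  from choice[OF this] obtain d where D: "\<forall>j. d j \<in> (\<Pi>\<^sub>E s\<in>G. enabled M s) \<and>
      (\<forall>S s. valid M G S \<longrightarrow> s \<in> states M \<longrightarrow>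
        reward (b j) M (md (d j)) G g [] s \<le> reward (b j) M S G g [] s)" ..
  have d: "d j \<in> (\<Pi>\<^sub>E s\<in>G. enabled M s)" for j
    using D by blast
  have opt: "reward (b j) M (md (d j)) G g [] s \<le> reward (b j) M S G g [] s"
    if "valid M G S" "s \<in> states M" for j S s
    using D that by blast
  have "finite (\<Pi>\<^sub>E s\<in>G. enabled M s)"
    using finite_G finite_acts by (intro finite_PiE) (auto simp: enabled_def)
  then have "finite (range d)" using d by (auto intro: finite_subset)
  then obtain j0 where inf: "infinite {j. d j = d j0}"
    using pigeonhole_infinite[OF infinite_UNIV_nat, of d] by auto
  obtain r :: "nat \<Rightarrow> nat" where "strict_mono r \<and> (\<forall>n. r n \<in> {j. d j = d j0})"
    using infinite_enumerate[OF inf] ..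
  then have r: "strict_mono r" "\<And>n. r n \<in> {j. d j = d j0}" by auto
  have v: "valid M G (md (d j0))" using d[of j0] by (intro valid_md) auto
  have "reward 1 M (md (d j0)) G g [] s \<le> reward 1 M S G g [] s"
    if "valid M G S" "s \<in> states M" for S s
  proof (rule LIMSEQ_le)
    have lim: "(\<lambda>n. b (r n)) \<longlonglongrightarrow> 1" using LIMSEQ_subseq_LIMSEQ[OF lim_b r(1)] by (simp add: o_def)
    show "(\<lambda>n. reward (b (r n)) M (md (d j0)) G g [] s) \<longlonglongrightarrow> reward 1 M (md (d j0)) G g [] s"
      "(\<lambda>n. reward (b (r n)) M S G g [] s) \<longlonglongrightarrow> reward 1 M S G g [] s"
      using b by (auto intro!: reward_discount_tendsto v that lim less_imp_le[OF b(2)])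
    show "\<exists>N. \<forall>n\<ge>N. reward (b (r n)) M (md (d j0)) G g [] s \<le> reward (b (r n)) M S G g [] s"
    proof (intro exI allI impI)
      fix n
      have "d (r n) = d j0" using r(2)[of n] by simp
      then show "reward (b (r n)) M (md (d j0)) G g [] s \<le> reward (b (r n)) M S G g [] s"
        using opt[OF that, of "r n"] by simp
    qed
  qed
  then show ?thesis using d[of j0] by (intro bexI[of _ "d j0"]) auto
qed

end

section \<open>Reachability probabilities as rewards\<close>

lemma stopped_mdp_nonterminal: "is_mdp M \<Longrightarrow> G \<subseteq> {s \<in> states M. \<not> terminal M s} \<Longrightarrow> stopped_mdp M G"
  by (auto simp: stopped_mdp_def)

lemma is_scheduler_valid:
  "is_scheduler M S \<Longrightarrow> G \<subseteq> {s \<in> states M. \<not> terminal M s} \<Longrightarrow> valid M G S"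
  by (auto simp: is_scheduler_def valid_def)

lemma history_Suc: "history \<omega> (Suc n) = history \<omega> n @ [(snd (\<omega> n), the (fst (\<omega> (Suc n))))]"
  by (simp add: history_def)

lemma history_cong: "(\<And>i. i \<le> n \<Longrightarrow> \<omega> i = \<omega>' i) \<Longrightarrow> history \<omega> n = history \<omega>' n"
  by (simp add: history_def)

locale scheduled_mdp =
  fixes M :: "('s, 'a) mdp" and S :: "('s, 'a) scheduler" and s\<^sub>0 :: 's
  assumes is_mdp: "is_mdp M" and scheduler: "is_scheduler M S" and start: "s\<^sub>0 \<in> states M"

sublocale scheduled_mdp \<subseteq> Ionescu_Tulcea "step_kernel M S s\<^sub>0" "\<lambda>_. step_space M"
  by (rule Ionescu_Tulcea_step_kernel[OF is_mdp scheduler start])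

context scheduled_mdp
begin

abbreviation steps :: "('a option \<times> 's) set" where
  "steps \<equiv> insert None (Some ` acts M) \<times> states M"

lemma finite_steps: "finite steps"
  using is_mdp by (auto simp: is_mdp_def)

lemma space_PiM_steps: "\<omega> \<in> space (PiM I (\<lambda>_. step_space M)) \<Longrightarrow> i \<in> I \<Longrightarrow> \<omega> i \<in> steps"
  by (auto simp: space_PiM step_space_def PiE_iff)

text \<open>The step space is finite, so finitely many coordinates carry the discrete sigma-algebra
  and every function of a finite prefix is measurable.\<close>

lemma sets_PiM_steps: "sets (PiM {0..<n::nat} (\<lambda>_. step_space M)) = Pow (space (PiM {0..<n} (\<lambda>_. step_space M)))"
proof -
  have "PiM {0..<n} (\<lambda>_. step_space M) = count_space ({0..<n} \<rightarrow>\<^sub>E steps)"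
    unfolding step_space_def using finite_steps by (intro count_space_PiM_finite) (auto intro: countable_finite)
  then show ?thesis by simp
qed

lemma measurable_PiM_steps: "f \<in> borel_measurable (PiM {0..<n::nat} (\<lambda>_. step_space M))"
  by (intro measurableI) (auto simp: sets_PiM_steps)

lemma nn_integral_step_kernel:
  "(\<integral>\<^sup>+x. f x \<partial>step_kernel M S s\<^sub>0 n \<omega>) = (\<Sum>x\<in>steps. ennreal (step_prob M S s\<^sub>0 n \<omega> x) * f x)"
proof -
  have "f \<in> borel_measurable (count_space steps)" for f :: "_ \<Rightarrow> ennreal" by simp
  then show ?thesis
    unfolding step_kernel_def step_space_def
    by (subst nn_integral_density) (auto simp: nn_integral_count_space_finite[OF finite_steps])
qed

lemma sum_step_prob:
  assumes "\<omega> \<in> space (PiM {0..<n} (\<lambda>_. step_space M))"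
  shows "(\<Sum>x\<in>steps. ennreal (step_prob M S s\<^sub>0 n \<omega> x)) = 1"
  using prob_space.emeasure_space_1[OF prob_space_P[OF assms]] nn_integral_step_kernel[of n \<omega> "\<lambda>_. 1"]
  by simp

lemma undefined_space: "(\<lambda>_. undefined) \<in> space (PiM {0..<0::nat} (\<lambda>_. step_space M))"
  by (simp add: space_PiM)

text \<open>\<open>C 0 n\<close> is the law of the first \<open>n\<close> coordinates; integrating
  out coordinate \<open>n\<close> leaves a finite sum that can be matched with
  \<open>step_exp\<close>.\<close>

lemma nn_integral_C_Suc:
  "(\<integral>\<^sup>+\<omega>. f \<omega> \<partial>C 0 (Suc n) (\<lambda>_. undefined)) =
     (\<integral>\<^sup>+\<omega>. (\<Sum>x\<in>steps. ennreal (step_prob M S s\<^sub>0 n \<omega> x) * f (fun_upd \<omega> n x)) \<partial>C 0 n (\<lambda>_. undefined))"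
proof -
  have "(\<integral>\<^sup>+\<omega>. f \<omega> \<partial>C 0 (Suc n) (\<lambda>_. undefined)) = (\<integral>\<^sup>+\<omega>. (\<integral>\<^sup>+\<omega>'. f \<omega>' \<partial>eP n \<omega>) \<partial>C 0 n (\<lambda>_. undefined))"
    unfolding C.simps
    by (subst nn_integral_bind[where B = "PiM {0..<Suc n} (\<lambda>_. step_space M)"])
       (auto simp: measurable_PiM_steps measurable_cong_sets[OF sets_C[OF undefined_space] refl])
  also have "\<dots> = (\<integral>\<^sup>+\<omega>. (\<Sum>x\<in>steps. ennreal (step_prob M S s\<^sub>0 n \<omega> x) * f (fun_upd \<omega> n x)) \<partial>C 0 n (\<lambda>_. undefined))"
    by (intro nn_integral_cong) (simp add: space_C[OF undefined_space] nn_integral_eP measurable_PiM_steps nn_integral_step_kernel)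
  finally show ?thesis .
qed

context
  fixes T :: "'s set"
begin

definition live :: "'s set" where
  "live = {s \<in> states M. \<not> terminal M s} - T"

definition hit :: "nat \<Rightarrow> (nat \<Rightarrow> 'a option \<times> 's) \<Rightarrow> bool" where
  "hit k \<omega> \<longleftrightarrow> (\<exists>i<k. snd (\<omega> i) \<in> T)"

lemma hit_Suc: "hit (Suc k) \<omega> \<longleftrightarrow> hit k \<omega> \<or> snd (\<omega> k) \<in> T"
  unfolding hit_def using less_Suc_eq by blast

text \<open>The probability, from \<open>s\<close> after history \<open>h\<close>, of visiting
  \<open>T\<close> within \<open>n\<close> steps. The start counts as a visit, so this corresponds
  to \<open>hit (Suc n)\<close>.\<close>

definition hit_prob :: "nat \<Rightarrow> ('s \<times> 'a) list \<Rightarrow> 's \<Rightarrow> real" where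
  "hit_prob n h s = (\<Sum>k\<le>n. gain M S live (indicator T) k h s)"

text \<open>
  The conditional probability of a hit within \<open>n + k\<close> steps given the first \<open>k\<close> steps; it is a
  martingale in \<open>k\<close>.
\<close>

definition forecast :: "nat \<Rightarrow> nat \<Rightarrow> (nat \<Rightarrow> 'a option \<times> 's) \<Rightarrow> ennreal" where
  "forecast n k \<omega> = (if hit k \<omega> then 1 else ennreal (hit_prob n (history \<omega> k) (snd (\<omega> k))))"

lemma live_mdp: "stopped_mdp M live"
  using is_mdp by (intro stopped_mdp_nonterminal) (auto simp: live_def)

lemma valid_live: "valid M live S"
  using scheduler by (rule is_scheduler_valid) (auto simp: live_def)

lemma hit_prob_Suc:
  "hit_prob (Suc n) h s = (if s \<in> live then step_exp M S (hit_prob n) h s else indicator T s)"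
  unfolding hit_prob_def sum_gain_Suc ..

lemma hit_prob_outside: "s \<notin> live \<Longrightarrow> hit_prob n h s = indicator T s"
  by (cases n) (simp add: hit_prob_def, simp add: hit_prob_Suc)

lemma hit_prob_nonneg: "s \<in> states M \<Longrightarrow> 0 \<le> hit_prob n h s"
  unfolding hit_prob_def
  by (intro sum_nonneg stopped_mdp.gain_nonneg[OF live_mdp valid_live]) auto

text \<open>The martingale property. A previous hit keeps the forecast at 1, a terminal state
  outside \<open>T\<close> keeps it at 0, and in a live state it is the recursion
  \<open>hit_prob_Suc\<close>.\<close>

lemma forecast_step:
  assumes \<omega>: "\<omega> \<in> space (PiM {0..<Suc k} (\<lambda>_. step_space M))"
  shows "(\<Sum>x\<in>steps. ennreal (step_prob M S s\<^sub>0 (Suc k) \<omega> x) * forecast n (Suc k) (fun_upd \<omega> (Suc k) x))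
         = forecast (Suc n) k \<omega>"
proof -
  define s where "s = snd (\<omega> k)"
  define h where "h = history \<omega> k"
  have s: "s \<in> states M" using space_PiM_steps[OF \<omega>, of k] by (auto simp: s_def)
  have hist: "history (fun_upd \<omega> (Suc k) x) (Suc k) = h @ [(s, the (fst x))]" for x
  proof -
    have "history (fun_upd \<omega> (Suc k) x) k = history \<omega> k" by (rule history_cong) simp
    then show ?thesis by (simp add: history_Suc s_def h_def)
  qed
  have hit: "hit (Suc k) (fun_upd \<omega> (Suc k) x) \<longleftrightarrow> hit k \<omega> \<or> s \<in> T" for x
  proof -
    have "hit k (fun_upd \<omega> (Suc k) x) \<longleftrightarrow> hit k \<omega>"
      unfolding hit_def by (intro ex_cong1 conj_cong refl) simp
    then show ?thesis by (simp add: hit_Suc s_def)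
  qed
  consider "hit k \<omega> \<or> s \<in> T" | "\<not> hit k \<omega>" "s \<notin> T" "terminal M s" | "\<not> hit k \<omega>" "s \<in> live"
    using s by (auto simp: live_def)
  then show ?thesis
  proof cases
    case 1
    then have "forecast n (Suc k) (fun_upd \<omega> (Suc k) x) = 1" for x
      by (simp only: forecast_def hit if_True)
    moreover have "forecast (Suc n) k \<omega> = 1"
      using 1 by (auto simp: forecast_def s_def[symmetric] hit_prob_Suc live_def)
    ultimately show ?thesis using sum_step_prob[OF \<omega>] by simp
  next
    case 2
    have "forecast n (Suc k) (fun_upd \<omega> (Suc k) x) = ennreal (hit_prob n (h @ [(s, the (fst x))]) (snd x))" for x
      using 2 by (simp add: forecast_def hit hist)
    \<comment> \<open>The only step of positive weight repeats \<open>s\<close>, where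
      \<open>hit_prob\<close> vanishes.\<close>
    then have "ennreal (step_prob M S s\<^sub>0 (Suc k) \<omega> x) * forecast n (Suc k) (fun_upd \<omega> (Suc k) x) = 0" for x
      using 2 by (auto simp: s_def[symmetric] Let_def hit_prob_outside live_def)
    moreover have "forecast (Suc n) k \<omega> = 0"
      using 2 by (auto simp: forecast_def s_def[symmetric] hit_prob_Suc live_def)
    ultimately show ?thesis by (simp only: sum.neutral_const)
  next
    case 3
    have nt: "\<not> terminal M s" "s \<notin> T" using 3 by (auto simp: live_def)
    have fin: "finite (acts M)" "finite (states M)"
      using is_mdp by (auto simp: is_mdp_def)
    have pos: "0 \<le> trans_prob M s a t" if "a \<in> acts M" "t \<in> states M" for a t
      using stopped_mdp.trans_nonneg[OF live_mdp s that] .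
    have "forecast n (Suc k) (fun_upd \<omega> (Suc k) x) = ennreal (hit_prob n (h @ [(s, the (fst x))]) (snd x))" for x
      using 3(1) nt by (simp add: forecast_def hit hist)
    then have "(\<Sum>x\<in>steps. ennreal (step_prob M S s\<^sub>0 (Suc k) \<omega> x) * forecast n (Suc k) (fun_upd \<omega> (Suc k) x))
        = (\<Sum>a\<in>insert None (Some ` acts M). \<Sum>t\<in>states M.
            ennreal (step_prob M S s\<^sub>0 (Suc k) \<omega> (a, t)) * ennreal (hit_prob n (h @ [(s, the a)]) t))"
      by (simp only: sum.cartesian_product split_def fst_conv snd_conv prod.collapse)
    also have "\<dots> = (\<Sum>a\<in>acts M. \<Sum>t\<in>states M. ennreal (pmf (S h s) a * trans_prob M s a t)
          * ennreal (hit_prob n (h @ [(s, a)]) t))"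
    proof -
      have "step_prob M S s\<^sub>0 (Suc k) \<omega> (None, t) = 0"
        "step_prob M S s\<^sub>0 (Suc k) \<omega> (Some a, t) = pmf (S h s) a * trans_prob M s a t" for a t
        using nt(1) by (simp_all add: s_def h_def Let_def)
      then show ?thesis using fin by (simp add: sum.reindex del: step_prob.simps)
    qed
    also have "\<dots> = (\<Sum>a\<in>acts M. \<Sum>t\<in>states M.
          ennreal (pmf (S h s) a * (trans_prob M s a t * hit_prob n (h @ [(s, a)]) t)))"
      by (intro sum.cong refl) (simp only: ennreal_mult[symmetric] pos hit_prob_nonneg pmf_nonneg mult_nonneg_nonneg mult.assoc)
    also have "\<dots> = ennreal (step_exp M S (hit_prob n) h s)"
    proof -
      let ?e = "\<lambda>a t. pmf (S h s) a * (trans_prob M s a t * hit_prob n (h @ [(s, a)]) t)"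
      have nn: "0 \<le> ?e a t" if "a \<in> acts M" "t \<in> states M" for a t
        using that by (intro mult_nonneg_nonneg pos hit_prob_nonneg pmf_nonneg)
      have "(\<Sum>a\<in>acts M. \<Sum>t\<in>states M. ennreal (?e a t)) = (\<Sum>a\<in>acts M. ennreal (\<Sum>t\<in>states M. ?e a t))"
        by (intro sum.cong refl sum_ennreal nn)
      also have "\<dots> = ennreal (\<Sum>a\<in>acts M. \<Sum>t\<in>states M. ?e a t)"
        by (intro sum_ennreal sum_nonneg nn)
      finally show ?thesis unfolding step_exp_def sum_distrib_left .
    qed
    also have "\<dots> = forecast (Suc n) k \<omega>"
      using 3 by (simp add: forecast_def hit_prob_Suc s_def[symmetric] h_def[symmetric])
    finally show ?thesis .
  qed
qed

text \<open>The forecast at \<open>k\<close> looks at coordinates 0 to \<open>k\<close>, hence the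
  law \<open>C 0 (Suc k)\<close>. Each induction step moves one step of the path from the prefix
  into the horizon; coordinate 0 is almost surely \<open>(None, s\<^sub>0)\<close>.\<close>

lemma nn_integral_forecast:
  "(\<integral>\<^sup>+\<omega>. forecast n k \<omega> \<partial>C 0 (Suc k) (\<lambda>_. undefined)) = ennreal (hit_prob (n + k) [] s\<^sub>0)"
proof (induction k arbitrary: n)
  case 0
  have "(\<Sum>x\<in>steps. ennreal (step_prob M S s\<^sub>0 0 \<omega> x) * forecast n 0 (fun_upd \<omega> 0 x)) =
      (\<Sum>x\<in>steps. if x = (None, s\<^sub>0) then ennreal (hit_prob n [] s\<^sub>0) else 0)" for \<omega>
    by (intro sum.cong refl) (auto simp: forecast_def hit_def history_def)
  also have "\<dots> = ennreal (hit_prob n [] s\<^sub>0)"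
    using start finite_steps by (subst sum.delta) auto
  finally have sum: "(\<Sum>x\<in>steps. ennreal (step_prob M S s\<^sub>0 0 \<omega> x) * forecast n 0 (fun_upd \<omega> 0 x))
      = ennreal (hit_prob n [] s\<^sub>0)" for \<omega> .
  show ?case
    unfolding nn_integral_C_Suc[of 0] sum
    using prob_space.emeasure_space_1[OF prob_space_C[OF undefined_space, of 0]] by (simp del: C.simps)
next
  case (Suc k)
  have "(\<integral>\<^sup>+\<omega>. forecast n (Suc k) \<omega> \<partial>C 0 (Suc (Suc k)) (\<lambda>_. undefined)) =
      (\<integral>\<^sup>+\<omega>. forecast (Suc n) k \<omega> \<partial>C 0 (Suc k) (\<lambda>_. undefined))"
    unfolding nn_integral_C_Suc[of "Suc k"]
    by (intro nn_integral_cong forecast_step) (simp add: space_C[OF undefined_space] del: C.simps)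
  then show ?case using Suc.IH[of "Suc n"] by (simp del: C.simps)
qed

lemma emeasure_hit:
  "emeasure (path_measure M S s\<^sub>0) {\<omega> \<in> space (path_measure M S s\<^sub>0). hit (Suc n) \<omega>} = ennreal (hit_prob n [] s\<^sub>0)"
proof -
  let ?J = "{0..<Suc n}" and ?u = "\<lambda>_::nat. undefined :: 'a option \<times> 's"
  define X where "X = {\<omega> \<in> space (PiM ?J (\<lambda>_. step_space M)). hit (Suc n) \<omega>}"
  have X: "X \<in> sets (PiM ?J (\<lambda>_. step_space M))"
    by (auto simp: sets_PiM_steps X_def)
  have PM: "path_measure M S s\<^sub>0 = PF.lim"
    by (simp add: path_measure_def)
  have "{\<omega> \<in> space (path_measure M S s\<^sub>0). hit (Suc n) \<omega>} = PF.emb UNIV ?J X"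
    by (auto simp: PM PF.space_lim prod_emb_def X_def hit_def space_PiM PiE_iff)
  then have "emeasure (path_measure M S s\<^sub>0) {\<omega> \<in> space (path_measure M S s\<^sub>0). hit (Suc n) \<omega>} = emeasure (CI ?J) X"
    using lim[OF _ X] by (simp add: PM)
  also have "\<dots> = emeasure (C 0 (Suc n) ?u) X"
    using emeasure_CI[OF order_refl X] sets.sets_into_space[OF X] by (simp add: prod_emb_id space_PiM del: C.simps)
  also have "\<dots> = (\<integral>\<^sup>+\<omega>. indicator X \<omega> \<partial>C 0 (Suc n) ?u)"
    using X by (subst nn_integral_indicator) (simp_all add: sets_C[OF undefined_space] del: C.simps)
  \<comment> \<open>With horizon 0 the forecast is the indicator of a hit at one of the coordinates
    0 to \<open>n\<close>.\<close>
  also have "\<dots> = (\<integral>\<^sup>+\<omega>. forecast 0 n \<omega> \<partial>C 0 (Suc n) ?u)"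
  proof (rule nn_integral_cong)
    fix \<omega> assume "\<omega> \<in> space (C 0 (Suc n) ?u)"
    then have \<omega>: "\<omega> \<in> space (PiM ?J (\<lambda>_. step_space M))" by (simp add: space_C[OF undefined_space] del: C.simps)
    have "hit_prob 0 (history \<omega> n) (snd (\<omega> n)) = indicator T (snd (\<omega> n))"
      by (auto simp: hit_prob_def live_def)
    then show "indicator X \<omega> = forecast 0 n \<omega>"
      using \<omega> by (auto simp: X_def forecast_def hit_def less_Suc_eq indicator_def)
  qed
  also have "\<dots> = ennreal (hit_prob n [] s\<^sub>0)"
    using nn_integral_forecast[where n = 0 and k = n] by (simp del: C.simps)
  finally show ?thesis .
qed

text \<open>The events \<open>A n\<close> of a visit within \<open>n\<close> steps increase to the
  reachability event, and their probabilities are the partial sums of the reward.\<close>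

lemma Pr_from_reach: "Pr_from M s\<^sub>0 S (reach M T) = reward 1 M S live (indicator T) [] s\<^sub>0"
proof -
  let ?P = "path_measure M S s\<^sub>0"
  interpret prob_space ?P by (rule path_measure_well_defined[OF is_mdp scheduler start])
  define A where "A n = {\<omega> \<in> space ?P. hit (Suc n) \<omega>}" for n
  have measure_A: "measure ?P (A n) = hit_prob n [] s\<^sub>0" for n
    unfolding A_def measure_def emeasure_hit by (simp add: hit_prob_nonneg start)
  have A_sets: "A n \<in> sets ?P" for n
  proof -
    have PM: "?P = PF.lim" by (simp add: path_measure_def)
    have "A n = (\<Union>i\<in>{..<Suc n}. {\<omega> \<in> space ?P. snd (\<omega> i) \<in> T})"
      by (auto simp: A_def hit_def)
    moreover have "{\<omega> \<in> space ?P. snd (\<omega> i) \<in> T} \<in> sets ?P" for i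
    proof -
      have "(\<lambda>\<omega>. \<omega> i) \<in> measurable (PiM UNIV (\<lambda>_. step_space M)) (step_space M)"
        by (rule measurable_component_singleton) simp
      moreover have "Measurable.pred (step_space M) (\<lambda>x. snd x \<in> T)"
        by (simp add: step_space_def)
      ultimately have "Measurable.pred (PiM UNIV (\<lambda>_. step_space M)) (\<lambda>\<omega>. snd (\<omega> i) \<in> T)"
        by (rule measurable_compose)
      then show ?thesis by (simp add: PM measurable_cong_sets[OF PF.sets_lim refl] pred_def PF.space_lim)
    qed
    ultimately show ?thesis by auto
  qed
  have "{\<omega> \<in> space ?P. reach M T \<omega>} = (\<Union>n. A n)"
  proof -
    have "snd (\<omega> i) \<in> states M" if "\<omega> \<in> space ?P" for \<omega> i
      using that space_PiM_steps[of \<omega> UNIV i] by (auto simp: path_measure_def PF.space_lim)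
    then show ?thesis by (fastforce simp: A_def hit_def reach_def path_until_def)
  qed
  moreover have "(\<lambda>n. measure ?P (A n)) \<longlonglongrightarrow> measure ?P (\<Union>n. A n)"
    using A_sets by (intro finite_Lim_measure_incseq incseq_SucI) (auto simp: A_def hit_Suc[of "Suc _"])
  ultimately have "(\<lambda>n. hit_prob n [] s\<^sub>0) \<longlonglongrightarrow> Pr_from M s\<^sub>0 S (reach M T)"
    by (simp add: measure_A Pr_from_def)
  moreover have "(\<lambda>n. hit_prob n [] s\<^sub>0) \<longlonglongrightarrow> reward 1 M S live (indicator T) [] s\<^sub>0"
    unfolding hit_prob_def by (rule stopped_mdp.reward_sums[OF live_mdp valid_live start])
  ultimately show ?thesis by (rule LIMSEQ_unique)
qed

end

end

section \<open>Occupation measures\<close>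

text \<open>
  Elimination of one state at a time: \<open>s\<close> is bypassed by its geometric series
  \<open>1 / (1 - K s s)\<close>, and the new kernel again has no closed set of states.
\<close>

lemma transient_occupation:
  fixes K :: "'s \<Rightarrow> 's \<Rightarrow> real"
  assumes "finite A"
    and "\<And>u t. u \<in> A \<Longrightarrow> t \<in> A \<Longrightarrow> 0 \<le> K u t"
    and "\<And>u. u \<in> A \<Longrightarrow> (\<Sum>t\<in>A. K u t) \<le> 1"
    and "\<And>B. B \<subseteq> A \<Longrightarrow> B \<noteq> {} \<Longrightarrow> \<exists>u\<in>B. (\<Sum>t\<in>B. K u t) < 1"
    and "\<And>t. t \<in> A \<Longrightarrow> 0 \<le> e t"
  shows "\<exists>x. (\<forall>t\<in>A. 0 \<le> x t) \<and> (\<forall>t\<in>A. x t = e t + (\<Sum>u\<in>A. x u * K u t))"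
  using assms
proof (induction A arbitrary: K e rule: finite_induct)
  case (insert s A)
  note fin = \<open>finite A\<close> and s = \<open>s \<notin> A\<close>
  define c where "c = 1 - K s s"
  have c: "0 < c" using insert.prems(3)[of "{s}"] by (auto simp: c_def)
  define K' where "K' u t = K u t + K u s * K s t / c" for u t
  define e' where "e' t = e t + e s * K s t / c" for t
  have row: "K u s + (\<Sum>t\<in>B. K u t) \<le> 1" if "u \<in> insert s A" "B \<subseteq> A" for u B
  proof -
    have "(\<Sum>t\<in>B. K u t) \<le> (\<Sum>t\<in>A. K u t)"
      using that insert.prems(1) fin by (intro sum_mono2) auto
    then show ?thesis using insert.prems(2)[OF that(1)] fin s by simp
  qed
  have K'_row: "(\<Sum>t\<in>B. K' u t) = (\<Sum>t\<in>B. K u t) + K u s * ((\<Sum>t\<in>B. K s t) / c)" for u B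
    by (simp add: K'_def sum.distrib sum_distrib_left sum_divide_distrib)
  have ratio: "0 \<le> (\<Sum>t\<in>B. K s t) / c" "(\<Sum>t\<in>B. K s t) / c \<le> 1" if "B \<subseteq> A" for B
    using row[OF _ that, of s] c insert.prems(1) that
    by (auto simp: c_def divide_le_eq_1 intro!: divide_nonneg_pos sum_nonneg)
  have K'_le: "(\<Sum>t\<in>B. K' u t) \<le> K u s + (\<Sum>t\<in>B. K u t)" if "u \<in> A" "B \<subseteq> A" for u B
    using mult_left_mono[OF ratio(2)[OF that(2)], of "K u s"] insert.prems(1)[of u s] that(1)
    by (simp add: K'_row)
  have "\<exists>x. (\<forall>t\<in>A. 0 \<le> x t) \<and> (\<forall>t\<in>A. x t = e' t + (\<Sum>u\<in>A. x u * K' u t))"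
  proof (rule insert.IH)
    show "0 \<le> K' u t" if "u \<in> A" "t \<in> A" for u t
      using that insert.prems(1) c by (auto simp: K'_def)
    show "(\<Sum>t\<in>A. K' u t) \<le> 1" if "u \<in> A" for u
      using K'_le[OF that order_refl] row[of u A] that by auto
    show "0 \<le> e' t" if "t \<in> A" for t
      using that insert.prems(1,4) c by (auto simp: e'_def)
    \<comment> \<open>If \<open>B\<close> were closed for \<open>K'\<close>, then
      \<open>insert s B\<close> could lose mass only at \<open>s\<close>, so every detour through
      \<open>s\<close> would lose some. Hence no member of \<open>B\<close> would move to
      \<open>s\<close>, and \<open>B\<close> would already be closed for \<open>K\<close>.\<close>
    show "\<exists>u\<in>B. (\<Sum>t\<in>B. K' u t) < 1" if B: "B \<subseteq> A" "B \<noteq> {}" for B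
    proof (rule ccontr)
      assume "\<not> ?thesis"
      then have ge: "\<And>u. u \<in> B \<Longrightarrow> 1 \<le> (\<Sum>t\<in>B. K' u t)" by (auto simp: not_less)
      have fB: "finite B" "s \<notin> B" using B fin s finite_subset by auto
      obtain v where v: "v \<in> insert s B" "(\<Sum>t\<in>insert s B. K v t) < 1"
        using insert.prems(3)[of "insert s B"] B by auto
      have "v = s"
      proof (rule ccontr)
        assume "v \<noteq> s"
        then have "v \<in> B" using v by auto
        then show False using ge[of v] K'_le[of v B] B v(2) fB by auto
      qed
      then have lt: "(\<Sum>t\<in>B. K s t) / c < 1" using v(2) fB c by (simp add: c_def)
      have "1 \<le> (\<Sum>t\<in>B. K u t)" if u: "u \<in> B" for u
      proof -
        have "K u s * ((\<Sum>t\<in>B. K s t) / c) \<ge> K u s"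
          using ge[OF u] row[of u B] u B by (auto simp: K'_row)
        moreover have "0 \<le> K u s" using insert.prems(1)[of u s] u B by auto
        ultimately have "K u s = 0"
          using lt mult_less_cancel_left2[of "K u s" "(\<Sum>t\<in>B. K s t) / c"] by fastforce
        then show ?thesis using ge[OF u] by (simp add: K'_row)
      qed
      then show False using insert.prems(3)[of B] B by force
    qed
  qed
  then obtain x where x: "\<And>t. t \<in> A \<Longrightarrow> 0 \<le> x t"
    and eq: "\<And>t. t \<in> A \<Longrightarrow> x t = e' t + (\<Sum>u\<in>A. x u * K' u t)" by blast
  \<comment> \<open>Back substitution: the equation for \<open>s\<close> is solved for its own
    occupation.\<close>
  define xs where "xs = (e s + (\<Sum>u\<in>A. x u * K u s)) / c"
  define y where "y = x(s := xs)"
  have y: "y s = xs" "\<And>t. t \<in> A \<Longrightarrow> y t = x t" using s by (auto simp: y_def)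
  have sumA: "(\<Sum>u\<in>A. y u * K u t) = (\<Sum>u\<in>A. x u * K u t)" for t
    using y by (intro sum.cong) auto
  have "0 \<le> xs"
    unfolding xs_def using x insert.prems(1,4) c by (auto intro!: divide_nonneg_pos add_nonneg_nonneg sum_nonneg)
  moreover have "xs = e s + (\<Sum>u\<in>insert s A. y u * K u s)"
  proof -
    have "xs * c = e s + (\<Sum>u\<in>A. x u * K u s)" using c by (simp add: xs_def)
    then show ?thesis using fin s y by (simp add: sumA c_def algebra_simps)
  qed
  moreover have "x t = e t + (\<Sum>u\<in>insert s A. y u * K u t)" if t: "t \<in> A" for t
  proof -
    have "x t = e t + e s * K s t / c + ((\<Sum>u\<in>A. x u * K u t) + (\<Sum>u\<in>A. x u * K u s) * K s t / c)"
      using eq[OF t] by (simp add: e'_def K'_def algebra_simps sum.distrib sum_distrib_left sum_divide_distrib)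
    also have "\<dots> = e t + (\<Sum>u\<in>A. x u * K u t) + xs * K s t"
      by (simp add: xs_def add_divide_distrib distrib_right)
    finally show ?thesis using fin s y by (simp add: sumA)
  qed
  ultimately show ?case using x y by (intro exI[of _ y]) auto
qed simp

context stopped_mdp
begin

text \<open>Otherwise playing \<open>a\<close> once at the start and \<open>d\<close> afterwards
  would beat the optimum; \<open>S\<close> is this deviating scheduler.\<close>

lemma md_optimal_step:
  assumes opt: "\<And>S s. valid M G S \<Longrightarrow> s \<in> states M \<Longrightarrow> w s \<le> reward 1 M S G g [] s"
    and d: "\<And>s. s \<in> G \<Longrightarrow> d s \<in> enabled M s"
    and w: "\<And>s. s \<in> states M \<Longrightarrow> w s = reward 1 M (md d) G g [] s"
    and s: "s \<in> G" and a: "a \<in> enabled M s"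
  shows "w s \<le> (\<Sum>t\<in>states M. trans_prob M s a t * w t)"
proof -
  define S where "S h t = (if h = [] \<and> t = s then return_pmf a else md d h t)" for h t
  have S: "valid M G S" using d a by (auto simp: valid_def S_def md_def policy_def)
  have later: "reward 1 M S G g [(s, a)] t = w t" if "t \<in> states M" for t
    unfolding w[OF that] by (rule reward_cong[where J = "\<lambda>h _ _. h \<noteq> []"]) (auto simp: S_def md_def policy_def)
  have "w s \<le> reward 1 M S G g [] s" using opt[OF S] s G_states by auto
  also have "\<dots> = step_exp M S (reward 1 M S G g) [] s" using reward_step[OF S s, of 1] by simp
  also have "\<dots> = (\<Sum>t\<in>states M. trans_prob M s a t * w t)"
    using step_exp_return[of S "[]" s a] a later by (simp add: S_def enabled_acts)
  finally show ?thesis .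
qed

text \<open>\<open>k\<close> is to be read as expected visits and \<open>y\<close> as expected uses
  of actions. Summing the flow equation against \<open>V\<close>, which satisfies the Bellman
  equation weighted by \<open>k\<close> on \<open>Y\<close>, cancels all of \<open>Y\<close> and
  leaves the arrivals outside it.\<close>

lemma flow_balance:
  assumes "Y \<subseteq> states M" "s\<^sub>0 \<in> states M"
    and k: "\<And>t. t \<in> states M \<Longrightarrow> k t = (if t = s\<^sub>0 then 1 else 0) + (\<Sum>u\<in>Y. \<Sum>a\<in>acts M. y u a * trans_prob M u a t)"
    and V: "\<And>s. s \<in> Y \<Longrightarrow> k s * V s = (\<Sum>a\<in>acts M. y s a * (\<Sum>t\<in>states M. trans_prob M s a t * V t))"
  shows "V s\<^sub>0 = (\<Sum>t\<in>states M - Y. k t * V t)"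
proof -
  have "(\<Sum>t\<in>states M. k t * V t) = (\<Sum>t\<in>states M. (if t = s\<^sub>0 then V t else 0)
      + (\<Sum>u\<in>Y. \<Sum>a\<in>acts M. y u a * trans_prob M u a t) * V t)"
    by (intro sum.cong) (auto simp: k distrib_right)
  also have "\<dots> = V s\<^sub>0 + (\<Sum>t\<in>states M. \<Sum>u\<in>Y. \<Sum>a\<in>acts M. y u a * (trans_prob M u a t * V t))"
    using assms(2) finite_states by (simp add: sum.distrib sum_distrib_right mult.assoc)
  also have "(\<Sum>t\<in>states M. \<Sum>u\<in>Y. \<Sum>a\<in>acts M. y u a * (trans_prob M u a t * V t)) = (\<Sum>u\<in>Y. k u * V u)"
    using V by (subst sum.swap, intro sum.cong refl, subst sum.swap) (simp add: sum_distrib_left)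
  also have "(\<Sum>t\<in>states M. k t * V t) = (\<Sum>t\<in>Y. k t * V t) + (\<Sum>t\<in>states M - Y. k t * V t)"
    by (subst add.commute, rule sum.subset_diff[OF assms(1) finite_states])
  finally show ?thesis by simp
qed

text \<open>The Bellman equation alone would allow a nonzero value on a closed set. The function
  that is 0 on \<open>B\<close> and a constant bound elsewhere is a supersolution, so
  \<open>reward_least\<close> applies.\<close>

lemma reward_zero_on_closed:
  assumes v: "valid M G S"
    and g: "\<And>s. s \<in> states M \<Longrightarrow> 0 \<le> g s"
    and B: "B \<subseteq> states M" "\<And>s. s \<in> B \<Longrightarrow> s \<notin> G \<Longrightarrow> g s = 0"
    and S: "\<And>h s. s \<in> B \<Longrightarrow> s \<in> G \<Longrightarrow> S h s = return_pmf (d s)"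
    and closed: "\<And>s t. s \<in> B \<Longrightarrow> s \<in> G \<Longrightarrow> t \<in> states M \<Longrightarrow> t \<notin> B \<Longrightarrow> trans_prob M s (d s) t = 0"
    and s: "s \<in> B"
  shows "reward 1 M S G g h s = 0"
proof -
  define c where "c = (\<Sum>s\<in>states M. g s)"
  have c: "0 \<le> c" "\<And>s. s \<in> states M \<Longrightarrow> g s \<le> c"
    using g finite_states by (auto simp: c_def intro: sum_nonneg member_le_sum)
  let ?\<phi> = "\<lambda>(h :: ('s \<times> 'a) list) s. if s \<in> B then 0 else c"
  have "reward 1 M S G g h s \<le> ?\<phi> h s"
  proof (rule reward_least[OF v])
    fix h s assume sG: "s \<in> G"
    show "step_exp M S ?\<phi> h s \<le> ?\<phi> h s"
    proof (cases "s \<in> B")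
      case True
      have "d s \<in> enabled M s" using valid_subset[OF v sG, of h] by (simp add: S[OF True sG])
      then have "step_exp M S ?\<phi> h s = (\<Sum>t\<in>states M. trans_prob M s (d s) t * ?\<phi> (h @ [(s, d s)]) t)"
        by (intro step_exp_return S True sG enabled_acts)
      also have "\<dots> = 0" using closed[OF True sG] by (intro sum.neutral) auto
      finally show ?thesis using True by simp
    next
      case False
      have "step_exp M S ?\<phi> h s \<le> step_exp M S (\<lambda>_ _. c) h s"
        using c(1) by (intro step_exp_mono[OF v sG]) auto
      then show ?thesis using False step_exp_const[OF v sG] by simp
    qed
  qed (use c B s in auto)
  moreover have "0 \<le> reward 1 M S G g h s"
    using g s B by (intro reward_nonneg[OF v]) auto
  ultimately show ?thesis using s by simp
qed

text \<open>\<open>w\<close> is a lower bound that \<open>d\<close> attains at the start, so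
  \<open>d\<close> visits only states where its value equals \<open>w\<close>. Among those in
  \<open>G - Z\<close> no set is closed under \<open>d\<close>: it would earn no
  \<open>\<rho>\<close> and so belong to \<open>Z\<close>. Hence the visits up to the entry into
  \<open>Z\<close> or the exit from \<open>G\<close> are finite in expectation, and \<open>k\<close>
  is their number.\<close>

lemma policy_flow:
  assumes d: "\<And>s. s \<in> G \<Longrightarrow> d s \<in> enabled M s"
    and s\<^sub>0: "s\<^sub>0 \<in> states M" "reward 1 M (md d) G g [] s\<^sub>0 = w s\<^sub>0"
    and w_step: "\<And>s a. s \<in> G \<Longrightarrow> a \<in> enabled M s \<Longrightarrow> w s \<le> (\<Sum>t\<in>states M. trans_prob M s a t * w t)"
    and w_le: "\<And>s. s \<in> states M \<Longrightarrow> w s \<le> reward 1 M (md d) G g [] s"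
    and \<rho>: "\<And>s. s \<in> states M \<Longrightarrow> 0 \<le> \<rho> s"
    and Z: "\<And>s. s \<in> G \<Longrightarrow> reward 1 M (md d) G g [] s = w s \<Longrightarrow> reward 1 M (md d) G \<rho> [] s = 0 \<Longrightarrow> s \<in> Z"
    and w_Z: "\<And>s. s \<in> Z \<Longrightarrow> w s = 0"
  shows "\<exists>k. (\<forall>t\<in>states M. 0 \<le> k t) \<and>
      (\<forall>t\<in>states M. k t = (if t = s\<^sub>0 then 1 else 0) + (\<Sum>u\<in>G - Z. k u * trans_prob M u (d u) t)) \<and>
      (\<forall>t\<in>states M \<inter> Z. k t * reward 1 M (md d) G g [] t = 0)"
proof -
  let ?V = "\<lambda>s. reward 1 M (md d) G g [] s"
  let ?P = "\<lambda>s t. trans_prob M s (d s) t"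
  have v: "valid M G (md d)" by (rule valid_md[OF d])
  have P: "0 \<le> ?P s t" if "s \<in> G" "t \<in> states M" for s t
    using trans_nonneg[OF _ enabled_acts[OF d]] that G_states by auto
  \<comment> \<open>The average excess of the value over \<open>w\<close> after the step is at most
    0 while every summand is nonnegative, so no successor has an excess.\<close>
  have succ: "?V t = w t" if s: "s \<in> G" "?V s = w s" and t: "t \<in> states M" "?P s t \<noteq> 0" for s t
  proof -
    have nn: "0 \<le> ?P s t * (?V t - w t)" if "t \<in> states M" for t
      using P[OF s(1) that] w_le[OF that] by simp
    have "(\<Sum>t\<in>states M. ?P s t * (?V t - w t)) = ?V s - (\<Sum>t\<in>states M. ?P s t * w t)"
      using reward_md_step[OF d s(1), of 1 g "[]"] by (simp add: sum_subtractf right_diff_distrib)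
    also have "\<dots> \<le> 0" using w_step[OF s(1) d[OF s(1)]] s(2) by simp
    finally have "(\<Sum>t\<in>states M. ?P s t * (?V t - w t)) = 0"
      using nn by (intro antisym sum_nonneg) auto
    then have "?P s t * (?V t - w t) = 0"
      using sum_nonneg_eq_0_iff[OF finite_states, of "\<lambda>t. ?P s t * (?V t - w t)"] nn t(1) by auto
    then show ?thesis using t(2) by simp
  qed
  define A where "A = {s \<in> G - Z. ?V s = w s}"
  have A: "A \<subseteq> G" "A \<subseteq> states M" "finite A" using G_states finite_G by (auto simp: A_def)
  have row: "(\<Sum>t\<in>B. ?P u t) \<le> 1" if "u \<in> G" "B \<subseteq> states M" for u B
  proof -
    have "(\<Sum>t\<in>B. ?P u t) \<le> (\<Sum>t\<in>states M. ?P u t)"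
      using that finite_states P by (intro sum_mono2) auto
    then show ?thesis using trans_sum[OF d[OF that(1)]] by simp
  qed
  have "\<exists>x. (\<forall>t\<in>A. 0 \<le> x t) \<and> (\<forall>t\<in>A. x t = (if t = s\<^sub>0 then 1 else 0) + (\<Sum>u\<in>A. x u * ?P u t))"
  proof (rule transient_occupation[OF A(3)])
    show "0 \<le> ?P u t" if "u \<in> A" "t \<in> A" for u t using P that A by auto
    show "(\<Sum>t\<in>A. ?P u t) \<le> 1" if "u \<in> A" for u using row that A by auto
    show "\<exists>u\<in>B. (\<Sum>t\<in>B. ?P u t) < 1" if B: "B \<subseteq> A" "B \<noteq> {}" for B
    proof (rule ccontr)
      assume "\<not> ?thesis"
      then have B1: "\<And>u. u \<in> B \<Longrightarrow> 1 \<le> (\<Sum>t\<in>B. ?P u t)" by (auto simp: not_less)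
      obtain s where s: "s \<in> B" using B by auto
      have "reward 1 M (md d) G \<rho> [] s = 0"
      proof (rule reward_zero_on_closed[OF v \<rho> _ _ _ _ s])
        fix u t assume u: "u \<in> B" "u \<in> G" and t: "t \<in> states M" "t \<notin> B"
        have "(\<Sum>t\<in>insert t B. ?P u t) \<le> 1" using row[OF u(2), of "insert t B"] t B A by auto
        then have "?P u t + (\<Sum>t\<in>B. ?P u t) \<le> 1" using t finite_subset[OF B(1) A(3)] by simp
        then show "?P u t = 0" using B1[OF u(1)] P[OF u(2) t(1)] by linarith
      qed (use B A in \<open>auto simp: md_def policy_def\<close>)
      then show False using Z[of s] s B by (auto simp: A_def)
    qed
  qed simp
  then obtain x where x: "\<And>t. t \<in> A \<Longrightarrow> 0 \<le> x t"
    and eq: "\<And>t. t \<in> A \<Longrightarrow> x t = (if t = s\<^sub>0 then 1 else 0) + (\<Sum>u\<in>A. x u * ?P u t)" by blast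
  \<comment> \<open>The flow equation extends the occupation from \<open>A\<close> to all states;
    outside \<open>A\<close> it yields the mass that arrives and stops there.\<close>
  define k where "k t = (if t = s\<^sub>0 then 1 else 0) + (\<Sum>u\<in>A. x u * ?P u t)" for t
  have kx: "k t = x t" if "t \<in> A" for t using eq[OF that] by (simp add: k_def)
  have zero: "?V t = w t" if tM: "t \<in> states M" and nz: "k t \<noteq> 0" for t
  proof (cases "t = s\<^sub>0")
    case False
    then obtain u where "u \<in> A" "?P u t \<noteq> 0"
      using nz sum.not_neutral_contains_not_neutral[of "\<lambda>u. x u * ?P u t" A] by (auto simp: k_def)
    then show ?thesis using succ[of u t] tM A by (auto simp: A_def)
  qed (use s\<^sub>0 in simp)
  have "(\<Sum>u\<in>G - Z. k u * ?P u t) = (\<Sum>u\<in>A. x u * ?P u t)" for t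
  proof -
    have "(\<Sum>u\<in>G - Z. k u * ?P u t) = (\<Sum>u\<in>A. k u * ?P u t)"
      using zero finite_G G_states by (intro sum.mono_neutral_right) (auto simp: A_def)
    then show ?thesis using kx by simp
  qed
  moreover have "0 \<le> k t" if "t \<in> states M" for t
    unfolding k_def using x P A that by (intro add_nonneg_nonneg sum_nonneg mult_nonneg_nonneg) auto
  moreover have "k t * ?V t = 0" if "t \<in> states M" "t \<in> Z" for t
    using zero[OF that(1)] w_Z[OF that(2)] by auto
  ultimately show ?thesis by (intro exI[of _ k]) (auto simp: k_def)
qed

end

section \<open>Minimising the bilinear criterion\<close>

text \<open>The objective \<open>q - p * (q + e)\<close> is continuous on the compact hull and has
  gradient \<open>(- (q + e), 1 - p, - p)\<close>. The last conclusion is first-order optimality of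
  the minimiser against the vertices.\<close>

lemma bilinear_minimizer:
  fixes X :: "(real \<times> real \<times> real) set"
  assumes X: "finite X"
    and bounds: "\<And>p q e. (p, q, e) \<in> X \<Longrightarrow> 0 \<le> q \<and> q \<le> p \<and> 0 \<le> e"
    and z: "(p\<^sub>0, q\<^sub>0, e\<^sub>0) \<in> convex hull X" "0 < p\<^sub>0" "q\<^sub>0 \<le> p\<^sub>0 * (q\<^sub>0 + e\<^sub>0)"
  obtains u p q e where "\<And>x. x \<in> X \<Longrightarrow> 0 \<le> u x" "sum u X = 1"
    "p = (\<Sum>x\<in>X. u x * fst x)" "q = (\<Sum>x\<in>X. u x * fst (snd x))" "e = (\<Sum>x\<in>X. u x * snd (snd x))"
    "0 < p" "q \<le> p * (q + e)"
    "\<And>x. x \<in> X \<Longrightarrow> (1 - p) * q - p * e - (q + e) * p \<le> (1 - p) * fst (snd x) - p * snd (snd x) - (q + e) * fst x"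
proof -
  define H where "H = convex hull X"
  define f where "f x = fst (snd x) - fst x * (fst (snd x) + snd (snd x))" for x :: "real \<times> real \<times> real"
  have H: "compact H" "convex H" "(p\<^sub>0, q\<^sub>0, e\<^sub>0) \<in> H"
    using z X by (auto simp: H_def finite_imp_compact_convex_hull)
  have "continuous_on H f" unfolding f_def by (intro continuous_intros)
  then obtain v where v: "v \<in> H" "\<And>x. x \<in> H \<Longrightarrow> f v \<le> f x"
    using continuous_attains_inf[OF H(1), of f] H(3) by blast
  have bH: "0 \<le> fst (snd x) \<and> fst (snd x) \<le> fst x \<and> 0 \<le> snd (snd x)" if "x \<in> H" for x
  proof -
    have "convex {x :: real \<times> real \<times> real. 0 \<le> fst (snd x) \<and> fst (snd x) \<le> fst x \<and> 0 \<le> snd (snd x)}"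
      by (auto simp: convex_def intro!: add_mono mult_left_mono add_nonneg_nonneg)
    then have "H \<subseteq> {x. 0 \<le> fst (snd x) \<and> fst (snd x) \<le> fst x \<and> 0 \<le> snd (snd x)}"
      unfolding H_def using bounds by (intro hull_minimal) auto
    then show ?thesis using that by auto
  qed
  have f0: "f (p\<^sub>0, q\<^sub>0, e\<^sub>0) \<le> 0" using z by (simp add: f_def)
  \<comment> \<open>A negative minimum forces a positive \<open>p\<close>-coordinate, since
    \<open>p = 0\<close> entails \<open>q = 0\<close> and objective 0. Otherwise the minimum is 0
    and the given point, whose \<open>p\<close>-coordinate is positive, is itself a
    minimiser.\<close>
  obtain v where v: "v \<in> H" "\<And>x. x \<in> H \<Longrightarrow> f v \<le> f x" and fv: "f v \<le> 0" and pos: "0 < fst v"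
  proof (cases "f v < 0")
    case True
    have "0 < fst v"
    proof (rule ccontr)
      assume "\<not> 0 < fst v"
      then have "fst v = 0" "fst (snd v) = 0" using bH[OF v(1)] by auto
      then show False using True by (simp add: f_def)
    qed
    then show ?thesis using that[of v] v True by auto
  next
    case False
    then show ?thesis using that[of "(p\<^sub>0, q\<^sub>0, e\<^sub>0)"] v f0 z(2) H(3) by fastforce
  qed
  obtain p q e where pqe: "v = (p, q, e)" by (cases v) auto
  from v(1) obtain u where u: "\<And>x. x \<in> X \<Longrightarrow> 0 \<le> u x" "sum u X = 1" "(\<Sum>x\<in>X. u x *\<^sub>R x) = v"
    unfolding H_def convex_hull_finite[OF X] by auto
  have coord: "p = (\<Sum>x\<in>X. u x * fst x)" "q = (\<Sum>x\<in>X. u x * fst (snd x))" "e = (\<Sum>x\<in>X. u x * snd (snd x))"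
    using arg_cong[OF u(3), of fst] arg_cong[OF u(3), of "\<lambda>x. fst (snd x)"] arg_cong[OF u(3), of "\<lambda>x. snd (snd x)"]
    by (simp_all add: pqe fst_sum snd_sum)
  have "(1 - p) * q - p * e - (q + e) * p \<le> (1 - p) * b - p * c - (q + e) * a"
    if x: "(a, b, c) \<in> X" for a b c
  proof (rule ccontr)
    \<comment> \<open>Along the segment to a vertex the objective is exactly
      \<open>f v + t * (D - t * N)\<close>: \<open>D\<close> is the directional derivative and
      \<open>N\<close> gives the quadratic part.\<close>
    define D where "D = (1 - p) * (b - q) - p * (c - e) - (q + e) * (a - p)"
    define N where "N = (a - p) * (b - q + (c - e))"
    assume "\<not> ?thesis"
    then have D: "D < 0" by (simp add: D_def algebra_simps)
    \<comment> \<open>Small enough for \<open>t * \<bar>N\<bar> < - D\<close>, and at most 1 to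
      remain on the segment.\<close>
    define t where "t = min 1 (- D / (2 * (\<bar>N\<bar> + 1)))"
    have t: "0 < t" "t \<le> 1" using D by (auto simp: t_def divide_neg_pos)
    have "t \<le> - D / (2 * (\<bar>N\<bar> + 1))" by (simp add: t_def)
    then have "t * (2 * (\<bar>N\<bar> + 1)) \<le> - D" by (subst (asm) pos_le_divide_eq) auto
    then have "2 * t + 2 * (t * \<bar>N\<bar>) \<le> - D" by (simp add: algebra_simps)
    moreover have "0 \<le> t * \<bar>N\<bar>" using t by simp
    ultimately have tN: "t * \<bar>N\<bar> < - D" using t by linarith
    have "(a, b, c) \<in> H" using x hull_inc[of _ X] by (simp add: H_def)
    then have "(1 - t) *\<^sub>R v + t *\<^sub>R (a, b, c) \<in> H"
      using H(2) v(1) t by (intro convexD) auto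
    then have "f v \<le> f ((1 - t) *\<^sub>R v + t *\<^sub>R (a, b, c))" by (rule v(2))
    also have "\<dots> = f v + t * (D - t * N)"
      by (simp add: f_def pqe D_def N_def algebra_simps)
    finally have "0 \<le> D - t * N" using t by (simp add: zero_le_mult_iff)
    moreover have "t * (- N) \<le> t * \<bar>N\<bar>" using t by (intro mult_left_mono) auto
    ultimately show False using tN by simp
  qed
  note first_order = this
  show thesis
  proof (rule that[OF u(1,2) coord])
    show "0 < p" using pos by (simp add: pqe)
    show "q \<le> p * (q + e)" using fv by (simp add: pqe f_def)
    show "(1 - p) * q - p * e - (q + e) * p \<le> (1 - p) * fst (snd x) - p * snd (snd x) - (q + e) * fst x"
      if "x \<in> X" for x
      using first_order[of "fst x" "fst (snd x)" "snd (snd x)"] that by simp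
  qed
qed

context stopped_mdp
begin

definition reward_vector where
  "reward_vector s\<^sub>0 p q e S = (reward 1 M S G p [] s\<^sub>0, reward 1 M S G q [] s\<^sub>0, reward 1 M S G e [] s\<^sub>0)"

lemma reward_combine:
  assumes "valid M G S" "s \<in> states M"
  shows "reward 1 M S G (\<lambda>s. a * p s + b * q s + c * e s) h s =
    a * reward 1 M S G p h s + b * reward 1 M S G q h s + c * reward 1 M S G e h s"
  using reward_add[OF assms, of 1 "\<lambda>s. a * p s + b * q s" "\<lambda>s. c * e s" h]
    reward_add[OF assms, of 1 "\<lambda>s. a * p s" "\<lambda>s. b * q s" h]
    reward_cmult[OF assms, of 1 a p h] reward_cmult[OF assms, of 1 b q h] reward_cmult[OF assms, of 1 c e h]
  by simp

text \<open>A vector outside the hull could be strictly separated from it. The separating functional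
  is the reward of the combined function \<open>g\<close>, for which some deterministic policy earns
  no more than \<open>S\<close>.\<close>

lemma reward_vector_in_hull:
  assumes S: "valid M G S" and s\<^sub>0: "s\<^sub>0 \<in> states M"
  shows "reward_vector s\<^sub>0 p q e S \<in> convex hull ((\<lambda>d. reward_vector s\<^sub>0 p q e (md d)) ` (\<Pi>\<^sub>E s\<in>G. enabled M s))"
    (is "_ \<in> convex hull ?X")
proof (rule ccontr)
  assume notin: "\<not> ?thesis"
  have "finite (\<Pi>\<^sub>E s\<in>G. enabled M s)"
    using finite_G finite_acts by (intro finite_PiE) (auto simp: enabled_def)
  then have "closed (convex hull ?X)"
    by (intro compact_imp_closed finite_imp_compact_convex_hull) simp
  then obtain n b where n: "inner n (reward_vector s\<^sub>0 p q e S) < b" "\<And>x. x \<in> convex hull ?X \<Longrightarrow> b < inner n x"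
    using separating_hyperplane_closed_point[OF convex_convex_hull _ notin] by blast
  obtain n1 n2 n3 where n_eq: "n = (n1, n2, n3)" by (cases n) auto
  define g where "g s = n1 * p s + n2 * q s + n3 * e s" for s
  have inner: "inner n (reward_vector s\<^sub>0 p q e S') = reward 1 M S' G g [] s\<^sub>0" if "valid M G S'" for S'
    unfolding g_def reward_combine[OF that s\<^sub>0] by (simp add: n_eq reward_vector_def)
  obtain d where d: "d \<in> (\<Pi>\<^sub>E s\<in>G. enabled M s)" "reward 1 M (md d) G g [] s\<^sub>0 \<le> reward 1 M S G g [] s\<^sub>0"
    using optimal_policy[of g] S s\<^sub>0 by blast
  have "valid M G (md d)" using d(1) by (intro valid_md) auto
  moreover have "reward_vector s\<^sub>0 p q e (md d) \<in> convex hull ?X" using d(1) by (intro hull_inc) auto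
  ultimately show False using n(1) n(2)[of "reward_vector s\<^sub>0 p q e (md d)"] d(2) inner S by simp
qed

end

lemma finite_pmf_exists:
  assumes "finite A" "\<And>a. a \<in> A \<Longrightarrow> 0 \<le> f a" "sum f A = 1"
  shows "\<exists>p. \<forall>a. pmf p a = (if a \<in> A then f a else 0)"
proof -
  have "(\<integral>\<^sup>+a. ennreal (if a \<in> A then f a else 0) \<partial>count_space UNIV) = (\<Sum>a\<in>A. ennreal (f a))"
    using assms(1) by (subst nn_integral_count_space'[of A]) auto
  also have "\<dots> = 1" using assms by (simp add: sum_ennreal)
  finally have "\<forall>a. pmf (embed_pmf (\<lambda>a. if a \<in> A then f a else 0)) a = (if a \<in> A then f a else 0)"
    using assms(2) by (intro allI pmf_embed_pmf) auto
  then show ?thesis by blast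
qed

lemma policy_apply: "policy \<delta> h s = \<delta> s"
  by (simp add: policy_def)

context stopped_mdp
begin

text \<open>The witness follows the normalised mixed occupation measure outside \<open>Z\<close> and
  remains in \<open>Z\<close> once there. Its vector is the minimiser minus a nonnegative
  \<open>g\<close>-neutral vector, a move that cannot increase the objective. If it earns no
  \<open>pr\<close>, a deterministic policy from the mixture serves instead.\<close>

lemma memoryless_suffices:
  fixes pr qr er :: "'s \<Rightarrow> real"
  assumes S: "valid M G S" and s\<^sub>0: "s\<^sub>0 \<in> states M"
    and nn: "\<And>s. s \<in> states M \<Longrightarrow> 0 \<le> qr s" "\<And>s. s \<in> states M \<Longrightarrow> qr s \<le> pr s" "\<And>s. s \<in> states M \<Longrightarrow> 0 \<le> er s"
    and pos: "0 < reward 1 M S G pr [] s\<^sub>0"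
    and le: "reward 1 M S G qr [] s\<^sub>0 \<le>
      reward 1 M S G pr [] s\<^sub>0 * (reward 1 M S G qr [] s\<^sub>0 + reward 1 M S G er [] s\<^sub>0)"
  obtains \<delta> where "\<And>s. s \<in> G \<Longrightarrow> set_pmf (\<delta> s) \<subseteq> enabled M s"
    "0 < reward 1 M (policy \<delta>) G pr [] s\<^sub>0"
    "reward 1 M (policy \<delta>) G qr [] s\<^sub>0 \<le> reward 1 M (policy \<delta>) G pr [] s\<^sub>0 *
       (reward 1 M (policy \<delta>) G qr [] s\<^sub>0 + reward 1 M (policy \<delta>) G er [] s\<^sub>0)"
proof -

  \<comment> \<open>The minimiser as a mixture of deterministic policies\<close>
  let ?\<Delta> = "\<Pi>\<^sub>E s\<in>G. enabled M s"
  let ?R = "\<lambda>d g. reward 1 M (md d) G g []"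
  have pr: "0 \<le> pr s" if "s \<in> states M" for s using nn(1,2)[OF that] by simp
  have enab: "d s \<in> enabled M s" if "d \<in> ?\<Delta>" "s \<in> G" for d s using that by auto
  have val: "valid M G (md d)" if "d \<in> ?\<Delta>" for d using enab[OF that] by (rule valid_md)
  define X where "X = (\<lambda>d. reward_vector s\<^sub>0 pr qr er (md d)) ` ?\<Delta>"
  have "finite ?\<Delta>"
    using finite_G finite_acts by (intro finite_PiE) (auto simp: enabled_def)
  then have fX: "finite X" by (simp add: X_def)
  have bX: "0 \<le> b \<and> b \<le> a \<and> 0 \<le> c" if x: "(a, b, c) \<in> X" for a b c
  proof -
    obtain d where d: "d \<in> ?\<Delta>" "a = ?R d pr s\<^sub>0" "b = ?R d qr s\<^sub>0" "c = ?R d er s\<^sub>0"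
      using x by (auto simp: X_def reward_vector_def)
    then show ?thesis
      using nn s\<^sub>0 by (auto intro!: reward_nonneg[OF val] reward_mono[OF val])
  qed
  have hull: "(reward 1 M S G pr [] s\<^sub>0, reward 1 M S G qr [] s\<^sub>0, reward 1 M S G er [] s\<^sub>0) \<in> convex hull X"
    using reward_vector_in_hull[OF S s\<^sub>0, of pr qr er] by (simp add: X_def reward_vector_def)
  obtain u p q e where u: "\<And>x. x \<in> X \<Longrightarrow> 0 \<le> u x" "sum u X = 1"
    and coord: "p = (\<Sum>x\<in>X. u x * fst x)" "q = (\<Sum>x\<in>X. u x * fst (snd x))" "e = (\<Sum>x\<in>X. u x * snd (snd x))"
    and p: "0 < p" and qe: "q \<le> p * (q + e)"
    and first_order: "\<And>x. x \<in> X \<Longrightarrow>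
      (1 - p) * q - p * e - (q + e) * p \<le> (1 - p) * fst (snd x) - p * snd (snd x) - (q + e) * fst x"
    by (rule bilinear_minimizer[OF fX _ hull pos le], erule bX, rule that)
  \<comment> \<open>The weights \<open>u\<close> live on vectors; \<open>r\<close> picks one policy
    for each vector.\<close>
  define r where "r = inv_into ?\<Delta> (\<lambda>d. reward_vector s\<^sub>0 pr qr er (md d))"
  have r: "r x \<in> ?\<Delta>" "reward_vector s\<^sub>0 pr qr er (md (r x)) = x" if "x \<in> X" for x
    using that inv_into_into[of x "\<lambda>d. reward_vector s\<^sub>0 pr qr er (md d)" ?\<Delta>]
      f_inv_into_f[of x "\<lambda>d. reward_vector s\<^sub>0 pr qr er (md d)" ?\<Delta>]
    unfolding X_def r_def by blast+
  have coord_r: "?R (r x) pr s\<^sub>0 = fst x" "?R (r x) qr s\<^sub>0 = fst (snd x)" "?R (r x) er s\<^sub>0 = snd (snd x)" if "x \<in> X" for x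
    using arg_cong[OF r(2)[OF that], of fst] arg_cong[OF r(2)[OF that], of "\<lambda>x. fst (snd x)"]
      arg_cong[OF r(2)[OF that], of "\<lambda>x. snd (snd x)"]
    by (simp_all add: reward_vector_def)

  \<comment> \<open>Linearisation at the minimiser\<close>
  define g where "g s = - (q + e) * pr s + (1 - p) * qr s + (- p) * er s" for s
  have Rg: "reward 1 M S' G g h s = (1 - p) * reward 1 M S' G qr h s - p * reward 1 M S' G er h s
      - (q + e) * reward 1 M S' G pr h s" if "valid M G S'" "s \<in> states M" for S' h s
    unfolding g_def reward_combine[OF that] by (simp add: algebra_simps)
  \<comment> \<open>The coefficients of \<open>g\<close> are the gradient of
    \<open>q - p * (q + e)\<close> at the minimiser, and \<open>Lv\<close> is this gradient applied
    to the minimiser.\<close>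
  define Lv where "Lv = (1 - p) * q - p * e - (q + e) * p"
  have Lv_le: "Lv \<le> ?R d g s\<^sub>0" if d: "d \<in> ?\<Delta>" for d
  proof -
    have "reward_vector s\<^sub>0 pr qr er (md d) \<in> X" using d by (auto simp: X_def)
    from first_order[OF this] show ?thesis
      unfolding Rg[OF val[OF d] s\<^sub>0] by (simp add: Lv_def reward_vector_def)
  qed
  \<comment> \<open>\<open>Lv\<close> is the weighted mean of values that are all at least
    \<open>Lv\<close>, so no policy of positive weight exceeds it.\<close>
  have tight: "?R (r x) g s\<^sub>0 = Lv" if x: "x \<in> X" "u x \<noteq> 0" for x
  proof -
    have "(\<Sum>x\<in>X. u x * (?R (r x) g s\<^sub>0 - Lv)) = (\<Sum>x\<in>X. u x * ((1 - p) * fst (snd x) - p * snd (snd x) - (q + e) * fst x)) - (\<Sum>x\<in>X. u x) * Lv"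
      unfolding sum_distrib_right sum_subtractf[symmetric]
      by (intro sum.cong refl) (simp add: Rg val r s\<^sub>0 coord_r algebra_simps)
    also have "(\<Sum>x\<in>X. u x * ((1 - p) * fst (snd x) - p * snd (snd x) - (q + e) * fst x)) =
        (1 - p) * (\<Sum>x\<in>X. u x * fst (snd x)) - p * (\<Sum>x\<in>X. u x * snd (snd x)) - (q + e) * (\<Sum>x\<in>X. u x * fst x)"
      unfolding sum_distrib_left sum_subtractf[symmetric] by (intro sum.cong refl) (simp add: algebra_simps)
    also have "\<dots> = Lv" by (simp only: coord[symmetric] Lv_def)
    finally have "(\<Sum>x\<in>X. u x * (?R (r x) g s\<^sub>0 - Lv)) = 0" using u(2) by simp
    moreover have "0 \<le> u x * (?R (r x) g s\<^sub>0 - Lv)" if "x \<in> X" for x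
      using u(1) Lv_le r(1) that by simp
    ultimately have "u x * (?R (r x) g s\<^sub>0 - Lv) = 0"
      using sum_nonneg_eq_0_iff[OF fX, of "\<lambda>x. u x * (?R (r x) g s\<^sub>0 - Lv)"] x(1) by auto
    then show ?thesis using x(2) by simp
  qed

  \<comment> \<open>Optimal values and the region where giving up is neutral\<close>
  obtain dg where dg: "dg \<in> ?\<Delta>" and dg_opt: "\<And>S s. valid M G S \<Longrightarrow> s \<in> states M \<Longrightarrow> ?R dg g s \<le> reward 1 M S G g [] s"
    using optimal_policy[of g] by blast
  define w where "w s = ?R dg g s" for s
  have w_step: "w s \<le> (\<Sum>t\<in>states M. trans_prob M s a t * w t)" if "s \<in> G" "a \<in> enabled M s" for s a
    using md_optimal_step[where w = w and g = g and d = dg] dg_opt enab[OF dg] that by (simp add: w_def)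
  have w_start: "?R (r x) g s\<^sub>0 = w s\<^sub>0" if "x \<in> X" "u x \<noteq> 0" for x
    using tight[OF that] dg_opt[OF val s\<^sub>0, OF r(1), OF that(1)] Lv_le[OF dg] by (simp add: w_def)

  \<comment> \<open>\<open>\<rho>\<close> marks all targets: as \<open>qr \<le> pr\<close>, zero
    expected \<open>\<rho>\<close> makes all three rewards vanish. The form with coefficients 1, 0,
    1 fits \<open>reward_combine\<close>.\<close>
  define \<rho> where "\<rho> s = 1 * pr s + 0 * qr s + 1 * er s" for s
  have R\<rho>: "reward 1 M S' G \<rho> h s = reward 1 M S' G pr h s + reward 1 M S' G er h s"
    if "valid M G S'" "s \<in> states M" for S' h s
    unfolding \<rho>_def reward_combine[OF that] by simp
  have \<rho>: "0 \<le> \<rho> s" if "s \<in> states M" for s using nn(3) pr that by (simp add: \<rho>_def)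
  have R_nn: "0 \<le> reward 1 M S' G pr h s" "0 \<le> reward 1 M S' G qr h s" "0 \<le> reward 1 M S' G er h s"
    "reward 1 M S' G qr h s \<le> reward 1 M S' G pr h s" if "valid M G S'" "s \<in> states M" for S' h s
    using nn pr that by (auto intro!: reward_nonneg reward_mono)
  have zero_g: "reward 1 M S' G g h s = 0" if "valid M G S'" "s \<in> states M" "reward 1 M S' G \<rho> h s = 0" for S' h s
  proof -
    have "reward 1 M S' G pr h s = 0" "reward 1 M S' G qr h s = 0" "reward 1 M S' G er h s = 0"
      using R\<rho>[OF that(1,2), of h] R_nn[OF that(1,2), of h] that(3) by linarith+
    then show ?thesis by (simp add: Rg[OF that(1,2)])
  qed
  obtain d\<rho> where d\<rho>: "d\<rho> \<in> ?\<Delta>" and d\<rho>_opt: "\<And>S s. valid M G S \<Longrightarrow> s \<in> states M \<Longrightarrow> ?R d\<rho> \<rho> s \<le> reward 1 M S G \<rho> [] s"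
    using optimal_policy[of \<rho>] by blast
  define Z where "Z = {s \<in> states M. ?R d\<rho> \<rho> s = 0 \<and> w s = 0}"
  have Z_abs: "pr s = 0" "qr s = 0" "er s = 0" if "s \<in> Z" "s \<notin> G" for s
  proof -
    have "s \<in> states M" "\<rho> s = 0" using that by (auto simp: Z_def reward_outside)
    then show "pr s = 0" "qr s = 0" "er s = 0" using nn[of s] by (simp_all add: \<rho>_def)
  qed
  \<comment> \<open>From \<open>Z\<close> the policy \<open>d\<rho>\<close> reaches only states of
    \<open>\<rho>\<close>-value 0. There it earns no \<open>g\<close> either, so
    \<open>w \<le> 0\<close>; as \<open>w s = 0\<close> is at most the average of \<open>w\<close>
    over the successors, all of them have \<open>w = 0\<close>.\<close>
  have Z_closed: "trans_prob M s (d\<rho> s) t = 0" if s: "s \<in> Z" "s \<in> G" and t: "t \<in> states M" "t \<notin> Z" for s t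
  proof (rule ccontr)
    let ?P = "\<lambda>t. trans_prob M s (d\<rho> s) t"
    assume P: "?P t \<noteq> 0"
    have Pnn: "0 \<le> ?P t" if "t \<in> states M" for t
      using trans_nonneg[OF _ enabled_acts[OF enab[OF d\<rho> s(2)]] that] s(2) G_states by auto
    have Vnn: "0 \<le> ?R d\<rho> \<rho> t" if "t \<in> states M" for t
      using \<rho> that by (intro reward_nonneg[OF val[OF d\<rho>]]) auto
    have "(\<Sum>t\<in>states M. ?P t * ?R d\<rho> \<rho> t) = 0"
      using reward_md_step[OF enab[OF d\<rho>] s(2), of 1 \<rho> "[]"] s(1) by (simp add: Z_def)
    then have "\<forall>t\<in>states M. ?P t * ?R d\<rho> \<rho> t = 0"
      using Pnn Vnn by (subst (asm) sum_nonneg_eq_0_iff[OF finite_states]) auto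
    then have Vz: "\<And>t. t \<in> states M \<Longrightarrow> ?P t \<noteq> 0 \<Longrightarrow> ?R d\<rho> \<rho> t = 0" by auto
    have wle: "?P t * w t \<le> 0" if "t \<in> states M" for t
      using dg_opt[OF val[OF d\<rho>] that] zero_g[OF val[OF d\<rho>] that Vz[OF that]] Pnn[OF that]
      by (cases "?P t = 0") (auto simp: w_def mult_nonneg_nonpos)
    have "0 \<le> (\<Sum>t\<in>states M. ?P t * w t)"
      using w_step[OF s(2) enab[OF d\<rho> s(2)]] s(1) by (simp add: Z_def)
    moreover have "(\<Sum>t\<in>states M. ?P t * w t) \<le> ?P t * w t"
      using wle sum_nonpos[of "states M - {t}" "\<lambda>t. ?P t * w t"] by (simp add: sum.remove[OF finite_states t(1)])
    ultimately have "?P t * w t = 0" using wle[OF t(1)] by linarith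
    then have "w t = 0" using P by simp
    then show False using t Vz[OF t(1) P] by (simp add: Z_def)
  qed
  define Y where "Y = G - Z"
  have Y: "Y \<subseteq> states M" using G_states by (auto simp: Y_def)

  \<comment> \<open>Occupation measures of the mixed policies\<close>
  define X' where "X' = {x \<in> X. u x \<noteq> 0}"
  have X': "finite X'" "\<And>x. x \<in> X' \<Longrightarrow> x \<in> X" "sum u X' = 1" using fX u(2)
    by (auto simp: X'_def sum.mono_neutral_left[of X "{x \<in> X. u x \<noteq> 0}" u])
  \<comment> \<open>The restriction to positive weights matters here: by \<open>w_start\<close>
    these policies attain \<open>w\<close> at the start, as \<open>policy_flow\<close>
    demands.\<close>
  have flow: "\<exists>k. (\<forall>t\<in>states M. 0 \<le> k t) \<and>
      (\<forall>t\<in>states M. k t = (if t = s\<^sub>0 then 1 else 0) + (\<Sum>v\<in>Y. k v * trans_prob M v (r x v) t)) \<and>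
      (\<forall>t\<in>states M \<inter> Z. k t * ?R (r x) g t = 0)" if x: "x \<in> X'" for x
    unfolding Y_def
  proof (rule policy_flow[where \<rho> = \<rho> and w = w])
    have rx: "r x \<in> ?\<Delta>" using r(1) X'(2) x by auto
    show "r x s \<in> enabled M s" if "s \<in> G" for s using enab[OF rx that] .
    show "?R (r x) g s\<^sub>0 = w s\<^sub>0" using w_start x by (simp add: X'_def)
    show "w s \<le> ?R (r x) g s" if "s \<in> states M" for s using dg_opt[OF val[OF rx] that] by (simp add: w_def)
    show "s \<in> Z" if "s \<in> G" "?R (r x) g s = w s" "?R (r x) \<rho> s = 0" for s
    proof -
      have s: "s \<in> states M" using that(1) G_states by auto
      have "0 \<le> ?R d\<rho> \<rho> s" using \<rho> by (intro reward_nonneg[OF val[OF d\<rho>] _ s]) auto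
      then show ?thesis
        using d\<rho>_opt[OF val[OF rx] s] zero_g[OF val[OF rx] s that(3)] that s by (simp add: Z_def)
    qed
  qed (use s\<^sub>0 w_step \<rho> in \<open>auto simp: Z_def\<close>)
  have "\<forall>x\<in>X'. \<exists>k. (\<forall>t\<in>states M. 0 \<le> k t) \<and>
      (\<forall>t\<in>states M. k t = (if t = s\<^sub>0 then 1 else 0) + (\<Sum>v\<in>Y. k v * trans_prob M v (r x v) t)) \<and>
      (\<forall>t\<in>states M \<inter> Z. k t * ?R (r x) g t = 0)"
    using flow by blast
  from bchoice[OF this] obtain k where kk: "\<forall>x\<in>X'. (\<forall>t\<in>states M. 0 \<le> k x t) \<and>
      (\<forall>t\<in>states M. k x t = (if t = s\<^sub>0 then 1 else 0) + (\<Sum>v\<in>Y. k x v * trans_prob M v (r x v) t)) \<and>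
      (\<forall>t\<in>states M \<inter> Z. k x t * ?R (r x) g t = 0)" ..
  have k_nn: "0 \<le> k x t" if "x \<in> X'" "t \<in> states M" for x t
    using kk that by blast
  have k: "k x t = (if t = s\<^sub>0 then 1 else 0) + (\<Sum>v\<in>Y. k x v * trans_prob M v (r x v) t)"
    if "x \<in> X'" "t \<in> states M" for x t
    using kk that by blast
  have k_Z: "k x t * ?R (r x) g t = 0" if "x \<in> X'" "t \<in> states M" "t \<in> Z" for x t
    using kk that by blast

  have u': "0 \<le> u x" if "x \<in> X'" for x using u(1) X'(2) that by blast
  have rX': "r x \<in> ?\<Delta>" if "x \<in> X'" for x using r(1) X'(2) that by blast
  \<comment> \<open>\<open>y1\<close> splits the visits of a deterministic policy by action. The
    flow equation is linear, so the mixtures \<open>y\<close> and \<open>kk\<close> satisfy it as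
    well.\<close>
  define y1 where "y1 x s a = (if a = r x s then k x s else 0)" for x s a
  define y where "y s a = (\<Sum>x\<in>X'. u x * y1 x s a)" for s a
  define kk where "kk t = (\<Sum>x\<in>X'. u x * k x t)" for t
  have y1_sum: "(\<Sum>a\<in>acts M. y1 x s a * f a) = k x s * f (r x s)" if "x \<in> X'" "s \<in> G" for x s f
  proof -
    have "r x s \<in> acts M" using enabled_acts[OF enab[OF rX'[OF that(1)] that(2)]] .
    moreover have "(\<Sum>a\<in>acts M. y1 x s a * f a) = (\<Sum>a\<in>acts M. if a = r x s then k x s * f (r x s) else 0)"
      by (intro sum.cong) (auto simp: y1_def)
    ultimately show ?thesis using finite_acts by simp
  qed
  have YG: "s \<in> G" if "s \<in> Y" for s using that by (simp add: Y_def)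
  have k_flow: "k x t = (if t = s\<^sub>0 then 1 else 0) + (\<Sum>v\<in>Y. \<Sum>a\<in>acts M. y1 x v a * trans_prob M v a t)"
    if "x \<in> X'" "t \<in> states M" for x t
    using k[OF that] by (simp add: y1_sum[OF that(1) YG])
  have kk_flow: "kk t = (if t = s\<^sub>0 then 1 else 0) + (\<Sum>v\<in>Y. \<Sum>a\<in>acts M. y v a * trans_prob M v a t)"
    if t: "t \<in> states M" for t
  proof -
    have "kk t = (\<Sum>x\<in>X'. u x * (if t = s\<^sub>0 then 1 else 0) +
        (\<Sum>v\<in>Y. \<Sum>a\<in>acts M. u x * y1 x v a * trans_prob M v a t))"
      unfolding kk_def using k_flow[OF _ t]
      by (intro sum.cong refl) (simp add: distrib_left sum_distrib_left mult.assoc)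
    also have "\<dots> = (if t = s\<^sub>0 then 1 else 0) + (\<Sum>x\<in>X'. \<Sum>v\<in>Y. \<Sum>a\<in>acts M. u x * y1 x v a * trans_prob M v a t)"
      by (simp add: sum.distrib sum_distrib_right[symmetric] X'(3))
    also have "(\<Sum>x\<in>X'. \<Sum>v\<in>Y. \<Sum>a\<in>acts M. u x * y1 x v a * trans_prob M v a t) =
        (\<Sum>v\<in>Y. \<Sum>a\<in>acts M. \<Sum>x\<in>X'. u x * y1 x v a * trans_prob M v a t)"
      by (subst sum.swap, intro sum.cong refl, rule sum.swap)
    finally show ?thesis by (simp add: y_def sum_distrib_right)
  qed
  have y_sum: "(\<Sum>a\<in>acts M. y s a) = kk s" if "s \<in> Y" for s
  proof -
    have "(\<Sum>a\<in>acts M. y s a) = (\<Sum>x\<in>X'. u x * (\<Sum>a\<in>acts M. y1 x s a * 1))"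
      unfolding y_def by (subst sum.swap) (simp add: sum_distrib_left)
    also have "\<dots> = kk s"
      unfolding kk_def using y1_sum[OF _ YG[OF that], of _ "\<lambda>_. 1"] by (intro sum.cong refl) simp
    finally show ?thesis .
  qed
  have y_nn: "0 \<le> y s a" if "s \<in> Y" for s a
    unfolding y_def y1_def using u' k_nn Y that by (intro sum_nonneg) auto
  have y_enabled: "y s a = 0" if s: "s \<in> Y" and a: "a \<notin> enabled M s" for s a
    unfolding y_def y1_def
    using a enab[OF rX' YG[OF s]] by (intro sum.neutral) auto

  \<comment> \<open>The memoryless randomised policy\<close>
  have "\<exists>D. set_pmf D \<subseteq> enabled M s \<and> (s \<in> Z \<longrightarrow> D = return_pmf (d\<rho> s)) \<and>
      (s \<in> Y \<longrightarrow> (\<forall>a\<in>acts M. y s a = kk s * pmf D a))" if s: "s \<in> G" for s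
  proof (cases "s \<in> Z")
    case True
    then show ?thesis using enab[OF d\<rho> s] by (intro exI[of _ "return_pmf (d\<rho> s)"]) (auto simp: Y_def)
  next
    case False
    then have sY: "s \<in> Y" using s by (simp add: Y_def)
    show ?thesis
    proof (cases "kk s = 0")
      \<comment> \<open>An unvisited state offers no occupation to normalise; \<open>dg s\<close>
        serves as an arbitrary enabled action.\<close>
      case True
      have "\<forall>a\<in>acts M. y s a = 0"
        using y_sum[OF sY] y_nn[OF sY] True sum_nonneg_eq_0_iff[OF finite_acts, of "y s"] by auto
      then show ?thesis
        using True False enab[OF dg s] by (intro exI[of _ "return_pmf (dg s)"]) auto
    next
      case kk: False
      have "0 \<le> kk s" using y_sum[OF sY] y_nn[OF sY] by (simp add: sum_nonneg flip: y_sum[OF sY])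
      then have "\<exists>D. \<forall>a. pmf D a = (if a \<in> acts M then y s a / kk s else 0)"
        using y_nn[OF sY] kk by (intro finite_pmf_exists finite_acts)
          (auto simp: sum_divide_distrib[symmetric] y_sum[OF sY])
      then obtain D where D: "\<And>a. pmf D a = (if a \<in> acts M then y s a / kk s else 0)" by blast
      have "set_pmf D \<subseteq> enabled M s"
      proof
        fix a assume "a \<in> set_pmf D"
        then have "y s a \<noteq> 0" by (auto simp: set_pmf_iff D split: if_splits)
        then show "a \<in> enabled M s" using y_enabled[OF sY] by blast
      qed
      then show ?thesis using D kk False by (intro exI[of _ D]) auto
    qed
  qed
  then have "\<forall>s\<in>G. \<exists>D. set_pmf D \<subseteq> enabled M s \<and> (s \<in> Z \<longrightarrow> D = return_pmf (d\<rho> s)) \<and>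
      (s \<in> Y \<longrightarrow> (\<forall>a\<in>acts M. y s a = kk s * pmf D a))" by blast
  from bchoice[OF this] obtain \<delta> where \<delta>: "\<forall>s\<in>G. set_pmf (\<delta> s) \<subseteq> enabled M s \<and>
      (s \<in> Z \<longrightarrow> \<delta> s = return_pmf (d\<rho> s)) \<and> (s \<in> Y \<longrightarrow> (\<forall>a\<in>acts M. y s a = kk s * pmf (\<delta> s) a))" ..
  have \<delta>_valid: "valid M G (policy \<delta>)" using \<delta> by (auto simp: valid_def policy_def)

  \<comment> \<open>Values of the policies and the part lost in \<open>Z\<close>\<close>
  have split: "states M - Y = (states M - G) \<union> (G \<inter> Z)" "(states M - G) \<inter> (G \<inter> Z) = {}"
    using G_states by (auto simp: Y_def)
  have split_sum: "sum f (states M - Y) = sum f (states M - G) + sum f (G \<inter> Z)" for f :: "'s \<Rightarrow> real"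
    unfolding split(1) using finite_states finite_G split(2) by (intro sum.union_disjoint) auto
  \<comment> \<open>Exits from \<open>G\<close> are paid by \<open>f\<close>, entries into
    \<open>Z\<close> inside \<open>G\<close> by what the policy still collects from there.\<close>
  have md_value: "?R (r x) f s\<^sub>0 = (\<Sum>t\<in>states M - G. k x t * f t) + (\<Sum>t\<in>G \<inter> Z. k x t * ?R (r x) f t)"
    if x: "x \<in> X'" for x f
  proof -
    have "?R (r x) f s\<^sub>0 = (\<Sum>t\<in>states M - Y. k x t * ?R (r x) f t)"
    proof (rule flow_balance[OF Y s\<^sub>0 k_flow[OF x]])
      fix s assume s: "s \<in> Y"
      show "k x s * ?R (r x) f s = (\<Sum>a\<in>acts M. y1 x s a * (\<Sum>t\<in>states M. trans_prob M s a t * ?R (r x) f t))"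
        using reward_md_step[OF enab[OF rX'[OF x]] YG[OF s], of 1 f "[]"] by (simp add: y1_sum[OF x YG[OF s]])
    qed
    then show ?thesis unfolding split_sum by (simp add: reward_outside)
  qed
  \<comment> \<open>Once in \<open>Z\<close>, the policy \<open>\<delta>\<close> follows
    \<open>d\<rho>\<close> and never leaves \<open>Z\<close> again, so it earns nothing more and
    only the exits from \<open>G\<close> contribute.\<close>
  have \<delta>_value: "reward 1 M (policy \<delta>) G f [] s\<^sub>0 = (\<Sum>t\<in>states M - G. kk t * f t)"
    if f: "\<And>s. s \<in> states M \<Longrightarrow> 0 \<le> f s" "\<And>s. s \<in> Z \<Longrightarrow> s \<notin> G \<Longrightarrow> f s = 0" for f
  proof -
    let ?V = "\<lambda>s. reward 1 M (policy \<delta>) G f [] s"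
    have zero: "?V s = 0" if "s \<in> Z" for s
      by (rule reward_zero_on_closed[OF \<delta>_valid f(1) _ f(2) _ Z_closed that])
         (use \<delta> in \<open>auto simp: Z_def policy_def\<close>)
    have "?V s\<^sub>0 = (\<Sum>t\<in>states M - Y. kk t * ?V t)"
    proof (rule flow_balance[OF Y s\<^sub>0 kk_flow])
      fix s assume s: "s \<in> Y"
      have "?V s = (\<Sum>a\<in>acts M. pmf (\<delta> s) a * (\<Sum>t\<in>states M. trans_prob M s a t * ?V t))"
        using reward_step[OF \<delta>_valid YG[OF s], of 1 f "[]"]
        by (simp add: step_exp_def reward_policy[of _ _ _ _ _ "[_]"] policy_apply)
      then have "kk s * ?V s = (\<Sum>a\<in>acts M. (kk s * pmf (\<delta> s) a) * (\<Sum>t\<in>states M. trans_prob M s a t * ?V t))"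
        by (simp add: sum_distrib_left mult.assoc)
      also have "\<dots> = (\<Sum>a\<in>acts M. y s a * (\<Sum>t\<in>states M. trans_prob M s a t * ?V t))"
        using \<delta> YG[OF s] s by (intro sum.cong refl) auto
      finally show "kk s * ?V s = (\<Sum>a\<in>acts M. y s a * (\<Sum>t\<in>states M. trans_prob M s a t * ?V t))" .
    qed
    then show ?thesis unfolding split_sum using zero by (simp add: reward_outside)
  qed
  \<comment> \<open>the reward lost by giving up on entering \<open>Z\<close>\<close>
  define B where "B f = (\<Sum>x\<in>X'. u x * (\<Sum>t\<in>G \<inter> Z. k x t * ?R (r x) f t))" for f
  have mix: "(\<Sum>x\<in>X'. u x * ?R (r x) f s\<^sub>0) = reward 1 M (policy \<delta>) G f [] s\<^sub>0 + B f"
    if f: "\<And>s. s \<in> states M \<Longrightarrow> 0 \<le> f s" "\<And>s. s \<in> Z \<Longrightarrow> s \<notin> G \<Longrightarrow> f s = 0" for f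
  proof -
    have "(\<Sum>x\<in>X'. u x * ?R (r x) f s\<^sub>0) = (\<Sum>x\<in>X'. \<Sum>t\<in>states M - G. u x * k x t * f t) + B f"
      unfolding B_def sum.distrib[symmetric]
      by (intro sum.cong refl) (simp add: md_value distrib_left sum_distrib_left mult.assoc)
    also have "(\<Sum>x\<in>X'. \<Sum>t\<in>states M - G. u x * k x t * f t) = (\<Sum>t\<in>states M - G. kk t * f t)"
      unfolding kk_def sum_distrib_right by (rule sum.swap)
    finally show ?thesis using \<delta>_value[OF f] by simp
  qed
  have B_nn: "0 \<le> B f" if "\<And>s. s \<in> states M \<Longrightarrow> 0 \<le> f s" for f
    unfolding B_def using u' k_nn G_states that
    by (intro sum_nonneg mult_nonneg_nonneg reward_nonneg val rX') auto
  \<comment> \<open>A state of \<open>Z\<close> visited by a mixed policy has \<open>g\<close>-value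
    \<open>w = 0\<close> under that policy; this is recorded in \<open>k_Z\<close>. Expanding
    \<open>g\<close> turns it into a linear relation between the three losses.\<close>
  have "B g = 0"
    unfolding B_def using k_Z G_states by (intro sum.neutral ballI) (auto intro!: sum.neutral)
  moreover have "B g = - (q + e) * B pr + (1 - p) * B qr + (- p) * B er"
    unfolding B_def sum_distrib_left sum.distrib[symmetric]
    by (intro sum.cong refl) (use G_states in \<open>auto simp: Rg val rX' algebra_simps\<close>)
  ultimately have Bg: "(1 - p) * B qr = (q + e) * B pr + p * B er" by (simp add: algebra_simps)

  \<comment> \<open>Comparison with the minimiser\<close>
  define p' where "p' = reward 1 M (policy \<delta>) G pr [] s\<^sub>0"
  define q' where "q' = reward 1 M (policy \<delta>) G qr [] s\<^sub>0"
  define e' where "e' = reward 1 M (policy \<delta>) G er [] s\<^sub>0"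
  have restrict: "(\<Sum>x\<in>X. u x * f x) = (\<Sum>x\<in>X'. u x * f x)" for f
    unfolding X'_def using fX by (intro sum.mono_neutral_right) auto
  have eqs: "p = p' + B pr" "q = q' + B qr" "e = e' + B er"
    unfolding p'_def q'_def e'_def
    using mix[of pr, OF pr Z_abs(1)] mix[of qr, OF nn(1) Z_abs(2)] mix[of er, OF nn(3) Z_abs(3)]
    by (simp_all add: coord restrict coord_r X'(2))
  have nn': "0 \<le> q'" "q' \<le> p'" "0 \<le> e'"
    unfolding p'_def q'_def e'_def using nn by (auto intro!: reward_nonneg reward_mono \<delta>_valid s\<^sub>0)
  have Bnn: "0 \<le> B pr" "0 \<le> B qr" "0 \<le> B er" using B_nn pr nn by auto
  \<comment> \<open>Exact expansion of the objective around the minimiser: the linear term is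
    \<open>B g = 0\<close>, and the remaining quadratic term has a definite sign.\<close>
  have key: "q' - p' * (q' + e') = q - p * (q + e) - B pr * (B qr + B er)"
    using Bg unfolding eqs by (simp add: algebra_simps)
  show thesis
  proof (cases "0 < p'")
    case True
    have "0 \<le> B pr * (B qr + B er)" using Bnn by simp
    then have "q' \<le> p' * (q' + e')" using key qe by linarith
    then show ?thesis using that[of \<delta>] \<delta> True unfolding p'_def q'_def e'_def by blast
  next
    case False
    \<comment> \<open>then all of \<open>v\<close> except its \<open>p\<close>-coordinate vanishes, and a policy in the mixture is itself a witness\<close>
    then have z: "p' = 0" "q' = 0" using nn' by auto
    have "B pr * (B qr + B er) \<le> 0" using key qe z by simp
    moreover have "0 < B pr" using eqs(1) p z by simp
    ultimately have "B qr + B er \<le> 0" by (simp add: mult_le_0_iff)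
    then have "B qr = 0" "B er = 0" using Bnn by auto
    then have q0: "q = 0" using eqs(2) z by simp
    then have "p * e = 0" using key z \<open>B qr = 0\<close> \<open>B er = 0\<close> by simp
    then have e0: "e = 0" using p by simp
    have bX': "0 \<le> fst (snd x)" "0 \<le> snd (snd x)" "0 \<le> fst x" if "x \<in> X" for x
      using bX[of "fst x" "fst (snd x)" "snd (snd x)"] that by auto
    obtain x where x: "x \<in> X" "u x * fst x \<noteq> 0"
      using p sum.not_neutral_contains_not_neutral[of "\<lambda>x. u x * fst x" X] by (auto simp: coord(1))
    have "u x * fst (snd x) = 0" "u x * snd (snd x) = 0"
      using sum_nonneg_eq_0_iff[OF fX, of "\<lambda>x. u x * fst (snd x)"] sum_nonneg_eq_0_iff[OF fX, of "\<lambda>x. u x * snd (snd x)"]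
        u(1) bX' q0 e0 coord(2,3) x(1) by auto
    then have "fst (snd x) = 0" "snd (snd x) = 0" "0 < fst x" using x bX'[OF x(1)] by auto
    then show ?thesis
      using that[of "\<lambda>s. return_pmf (r x s)"] enab[OF r(1)[OF x(1)]] coord_r[OF x(1)]
      by (auto simp: md_def)
  qed
qed

end

section \<open>Schedulers that stop at the causes\<close>

text \<open>\<open>g'\<close> pays at the earlier stop no more than continuing would earn, so the
  reward of continuing is a supersolution for the process stopped on leaving
  \<open>G\<close>.\<close>

lemma reward_ge_stop_at:
  assumes G': "stopped_mdp M G'" and G: "G \<subseteq> G'" and S: "valid M G' S"
    and g: "\<And>s. s \<in> states M \<Longrightarrow> 0 \<le> g s"
    and later: "\<And>h s. s \<in> G' - G \<Longrightarrow> g' s \<le> reward 1 M S G' g h s"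
    and g': "\<And>s. s \<in> states M - G' \<Longrightarrow> g' s = g s"
    and s: "s \<in> states M"
  shows "reward 1 M S G g' h s \<le> reward 1 M S G' g h s"
proof -
  interpret G': stopped_mdp M G' by fact
  interpret G: stopped_mdp M G using G'.mdp G G'.G_states G'.G_nonterminal by unfold_locales auto
  have S': "valid M G S" using S G by (auto simp: valid_def)
  show ?thesis
  proof (rule G.reward_least[OF S' _ _ _ s])
    show "0 \<le> reward 1 M S G' g h s" if "s \<in> states M" for h s
      using that g by (intro G'.reward_nonneg[OF S]) auto
    show "g' s \<le> reward 1 M S G' g h s" if "s \<in> states M" "s \<notin> G" for h s
      using that later[of s h] g'[of s] G'.reward_outside[of s 1 S g h] by (cases "s \<in> G'") auto
    show "step_exp M S (reward 1 M S G' g) h s \<le> reward 1 M S G' g h s" if "s \<in> G" for h s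
      using G'.reward_step[OF S, of s 1 g h] that G by auto
  qed
qed

text \<open>If the early payment equals the later earnings, each reward is a supersolution for the
  other process, and \<open>reward_least\<close> gives both inequalities.\<close>

lemma reward_stop_at:
  assumes G': "stopped_mdp M G'" and G: "G \<subseteq> G'" and S: "valid M G' S"
    and g: "\<And>s. s \<in> states M \<Longrightarrow> 0 \<le> g s"
    and later: "\<And>h s. s \<in> G' - G \<Longrightarrow> reward 1 M S G' g h s = g' s"
    and g': "\<And>s. s \<in> states M - G' \<Longrightarrow> g' s = g s"
    and s: "s \<in> states M"
  shows "reward 1 M S G' g h s = reward 1 M S G g' h s"
proof (rule antisym)
  interpret G': stopped_mdp M G' by fact
  interpret G: stopped_mdp M G using G'.mdp G G'.G_states G'.G_nonterminal by unfold_locales auto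
  have S': "valid M G S" using S G by (auto simp: valid_def)
  have ge: "reward 1 M S G g' h s \<le> reward 1 M S G' g h s" if "s \<in> states M" for h s
    by (rule reward_ge_stop_at[OF G' G S g _ g' that]) (simp_all add: later)
  show "reward 1 M S G g' h s \<le> reward 1 M S G' g h s" using ge[OF s] .
  have g'_nn: "0 \<le> g' s" if "s \<in> states M" "s \<notin> G" for s
  proof -
    have "0 \<le> reward 1 M S G' g [] s" by (rule G'.reward_nonneg[OF S]) (use g that in auto)
    then show ?thesis using that later[of s "[]"] g'[of s] g[of s] by (cases "s \<in> G'") auto
  qed
  show "reward 1 M S G' g h s \<le> reward 1 M S G g' h s"
  proof (rule G'.reward_least[OF S _ _ _ s])
    show "0 \<le> reward 1 M S G g' h s" if "s \<in> states M" for h s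
      using g'_nn that by (intro G.reward_nonneg[OF S']) auto
    show "g s \<le> reward 1 M S G g' h s" if "s \<in> states M" "s \<notin> G'" for h s
    proof -
      have "s \<notin> G" using that(2) G by blast
      then show ?thesis using that g'[of s] by (simp add: G.reward_outside)
    qed
    show "step_exp M S (reward 1 M S G g') h s \<le> reward 1 M S G g' h s" if "s \<in> G'" for h s
    proof (cases "s \<in> G")
      case True
      then show ?thesis using G.reward_step[OF S', of s 1 g' h] by simp
    next
      case False
      have "step_exp M S (reward 1 M S G g') h s \<le> step_exp M S (reward 1 M S G' g) h s"
        using ge by (intro G'.step_exp_mono[OF S that]) auto
      also have "\<dots> = reward 1 M S G' g h s" using G'.reward_step[OF S that, of 1 g h] by simp
      also have "\<dots> = reward 1 M S G g' h s" using later[of s h] False that by (simp add: G.reward_outside)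
      finally show ?thesis .
    qed
  qed
qed

lemma Pr_reach:
  assumes "is_mdp M" "is_scheduler M S"
  shows "Pr M S (reach M T) = reward 1 M S ({s \<in> states M. \<not> terminal M s} - T) (indicator T) [] (init M)"
proof -
  interpret scheduled_mdp M S "init M"
    using assms by unfold_locales (auto simp: is_mdp_def)
  show ?thesis unfolding Pr_def Pr_from_reach live_def ..
qed

text \<open>Visiting both sets is not a reachability event, but visiting their union is;
  inclusion-exclusion thus makes \<open>Pr_reach\<close> applicable.\<close>

lemma Pr_cond_reach:
  assumes "is_mdp M" "is_scheduler M S"
  shows "Pr_cond M S (reach M A) (reach M B) =
    (Pr M S (reach M A) + Pr M S (reach M B) - Pr M S (reach M (A \<union> B))) / Pr M S (reach M B)"
proof -
  have i: "init M \<in> states M" using assms(1) by (simp add: is_mdp_def)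
  let ?P = "path_measure M S (init M)"
  note wd = path_measure_well_defined[OF assms i]
  interpret prob_space ?P by (rule wd)
  let ?E = "\<lambda>T. {\<omega> \<in> space ?P. reach M T \<omega>}"
  have sets: "?E T \<in> events" for T using wd(2) by (simp add: reach_def)
  have un: "?E (A \<union> B) = ?E A \<union> ?E B" by (auto simp: reach_def path_until_def)
  have "measure ?P (?E A \<inter> ?E B) = measure ?P (?E A) + measure ?P (?E B) - measure ?P (?E A \<union> ?E B)"
    using finite_measure_Union'[OF sets[of A] sets[of B]] finite_measure_Diff'[OF sets[of B] sets[of A]]
    by (simp add: Int_commute)
  moreover have "{\<omega> \<in> space ?P. reach M A \<omega> \<and> reach M B \<omega>} = ?E A \<inter> ?E B" by auto
  ultimately show ?thesis by (simp add: Pr_cond_def cond_prob_def Pr_def Pr_from_def un)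
qed

locale cause_effect =
  fixes M :: "('s, 'a) mdp" and Eff Cause :: "'s set"
  assumes is_mdp: "is_mdp M" and Eff: "Eff \<subseteq> states M" "\<And>s. s \<in> Eff \<Longrightarrow> terminal M s"
    and Cause: "Cause \<subseteq> states M - Eff"
begin

text \<open>The two stopping regions: \<open>Eff\<close> is decided at terminal states, while the
  rewards of the criterion are collected already at the first cause.\<close>

definition NT :: "'s set" where "NT = {s \<in> states M. \<not> terminal M s}"
definition N :: "'s set" where "N = NT - Cause"

sublocale NT: stopped_mdp M NT
  using is_mdp by (rule stopped_mdp_nonterminal) (simp add: NT_def)

sublocale N: stopped_mdp M N
  using is_mdp by (rule stopped_mdp_nonterminal) (auto simp: NT_def N_def)

lemma init: "init M \<in> states M" using is_mdp by (simp add: is_mdp_def)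

lemma is_scheduler_iff: "is_scheduler M S \<longleftrightarrow> valid M NT S"
  by (auto simp: is_scheduler_def valid_def NT_def)

lemma valid_N: "valid M NT S \<Longrightarrow> valid M N S"
  by (auto simp: valid_def N_def)

text \<open>One policy minimising the probability of \<open>Eff\<close> from all states at once, so
  that it can be started at whichever cause is reached first.\<close>

definition dmin :: "'s \<Rightarrow> 'a" where
  "dmin = (SOME d. d \<in> (\<Pi>\<^sub>E s\<in>NT. enabled M s) \<and> (\<forall>S s. valid M NT S \<longrightarrow> s \<in> states M \<longrightarrow>
     reward 1 M (md d) NT (indicator Eff) [] s \<le> reward 1 M S NT (indicator Eff) [] s))"

definition m :: "'s \<Rightarrow> real" where
  "m s = reward 1 M (md dmin) NT (indicator Eff) [] s"

lemma dmin: "s \<in> NT \<Longrightarrow> dmin s \<in> enabled M s"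
  and m_le: "valid M NT S \<Longrightarrow> s \<in> states M \<Longrightarrow> m s \<le> reward 1 M S NT (indicator Eff) [] s"
proof -
  have "\<exists>d. d \<in> (\<Pi>\<^sub>E s\<in>NT. enabled M s) \<and> (\<forall>S s. valid M NT S \<longrightarrow> s \<in> states M \<longrightarrow>
     reward 1 M (md d) NT (indicator Eff) [] s \<le> reward 1 M S NT (indicator Eff) [] s)"
    using NT.optimal_policy[of "indicator Eff"] by blast
  from someI_ex[OF this, folded dmin_def]
  have d: "dmin \<in> (\<Pi>\<^sub>E s\<in>NT. enabled M s)" and opt: "\<forall>S s. valid M NT S \<longrightarrow> s \<in> states M \<longrightarrow>
     reward 1 M (md dmin) NT (indicator Eff) [] s \<le> reward 1 M S NT (indicator Eff) [] s" by auto
  show "s \<in> NT \<Longrightarrow> dmin s \<in> enabled M s" using d by auto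
  show "valid M NT S \<Longrightarrow> s \<in> states M \<Longrightarrow> m s \<le> reward 1 M S NT (indicator Eff) [] s"
    using opt by (simp add: m_def)
qed

lemma valid_dmin: "valid M NT (md dmin)"
  using dmin by (rule NT.valid_md)

lemma m_bounds: "s \<in> states M \<Longrightarrow> 0 \<le> m s" "s \<in> states M \<Longrightarrow> m s \<le> 1"
  unfolding m_def by (auto intro!: NT.reward_nonneg NT.reward_le valid_dmin simp: indicator_def)

lemma m_outside: "s \<notin> NT \<Longrightarrow> m s = indicator Eff s"
  unfolding m_def by (rule NT.reward_outside)

lemma Eff_NT: "NT - Eff = NT" "NT - (Eff \<union> Cause) = N" "NT - Cause = N"
  using Eff by (auto simp: NT_def N_def)

text \<open>The infimum is a minimum, attained by \<open>md dmin\<close>; the transition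
  probabilities of \<open>\<gamma>\<close> are therefore realised by a policy of
  \<open>M\<close>.\<close>

lemma Pr_min_Eff:
  assumes s: "s \<in> states M"
  shows "Pr_min M s (reach M Eff) = m s"
proof -
  have eq: "Pr_from M s S (reach M Eff) = reward 1 M S NT (indicator Eff) [] s" if "is_scheduler M S" for S
  proof -
    interpret scheduled_mdp M S s using is_mdp that s by unfold_locales
    show ?thesis unfolding Pr_from_reach live_def NT_def[symmetric] Eff_NT ..
  qed
  show ?thesis
    unfolding Pr_min_def
  proof (rule cInf_eq_minimum)
    show "m s \<in> (\<lambda>S. Pr_from M s S (reach M Eff)) ` {S. is_scheduler M S}"
      using valid_dmin by (intro image_eqI[of _ _ "md dmin"]) (auto simp: eq is_scheduler_iff m_def)
    show "m s \<le> x" if "x \<in> (\<lambda>S. Pr_from M s S (reach M Eff)) ` {S. is_scheduler M S}" for x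
      using that m_le[OF _ s] by (auto simp: eq is_scheduler_iff)
  qed
qed

text \<open>The payment at the first cause: the least probability of \<open>Eff\<close> from
  there.\<close>

definition qr :: "'s \<Rightarrow> real" where "qr s = m s * indicator Cause s"

lemma indicator_union: "indicator (Eff \<union> Cause) s = (indicator Cause s + indicator Eff s :: real)"
  using Cause by (auto simp: indicator_def)

lemma Pr_Cause: "is_scheduler M S \<Longrightarrow> Pr M S (reach M Cause) = reward 1 M S N (indicator Cause) [] (init M)"
  using Pr_reach[OF is_mdp, of S Cause] by (simp add: NT_def[symmetric] Eff_NT)

lemma Pr_Eff: "is_scheduler M S \<Longrightarrow> Pr M S (reach M Eff) = reward 1 M S NT (indicator Eff) [] (init M)"
  using Pr_reach[OF is_mdp, of S Eff] by (simp add: NT_def[symmetric] Eff_NT)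

lemma Pr_Eff_Cause:
  assumes "is_scheduler M S"
  shows "Pr M S (reach M (Eff \<union> Cause)) =
    reward 1 M S N (indicator Cause) [] (init M) + reward 1 M S N (indicator Eff) [] (init M)"
proof -
  have "indicator (Eff \<union> Cause) = (\<lambda>s. indicator Cause s + indicator Eff s :: real)"
    using indicator_union by auto
  then show ?thesis
    using Pr_reach[OF is_mdp assms, of "Eff \<union> Cause"] assms N.reward_add[of S "init M" 1] init
    by (simp add: NT_def[symmetric] Eff_NT is_scheduler_iff valid_N)
qed

text \<open>After a cause every continuation reaches \<open>Eff\<close> with probability at least
  \<open>m\<close>, by minimality applied to the shifted scheduler.\<close>

lemma reward_qr_Eff_le:
  assumes S: "valid M NT S" and s: "s \<in> states M"
  shows "reward 1 M S N qr [] s + reward 1 M S N (indicator Eff) [] s \<le> reward 1 M S NT (indicator Eff) [] s"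
proof -
  have "reward 1 M S N (\<lambda>s. qr s + indicator Eff s) [] s \<le> reward 1 M S NT (indicator Eff) [] s"
  proof (rule reward_ge_stop_at[OF NT.stopped_mdp_axioms _ S _ _ _ s])
    fix h t assume t: "t \<in> NT - N"
    then have tM: "t \<in> states M" by (auto simp: NT_def)
    have "m t \<le> reward 1 M S NT (indicator Eff) h t"
      using m_le[OF NT.valid_shift[OF S, of h] tM] reward_shift[of 1 M S h NT "indicator Eff" "[]" t] by simp
    then show "qr t + indicator Eff t \<le> reward 1 M S NT (indicator Eff) h t"
      using t Eff(2)[of t] by (auto simp: qr_def N_def NT_def indicator_def)
  qed (use Cause in \<open>auto simp: N_def qr_def m_outside indicator_def\<close>)
  then show ?thesis using N.reward_add[OF valid_N[OF S] s, of 1] by simp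
qed

text \<open>With \<open>t\<close> for the probability of \<open>Eff\<close>, the violated inequality
  reads \<open>t * (1 - p) \<le> e\<close>. Since \<open>q + e \<le> t\<close> and
  \<open>p \<le> 1\<close>, minimising after the cause preserves it, and it becomes
  \<open>q \<le> p * (q + e)\<close>.\<close>

lemma memoryless_counterexample:
  assumes S: "is_scheduler M S" "0 < Pr M S (reach M Cause)"
    "Pr_cond M S (reach M Eff) (reach M Cause) \<le> Pr M S (reach M Eff)"
  obtains \<delta> where "\<And>s. s \<in> N \<Longrightarrow> set_pmf (\<delta> s) \<subseteq> enabled M s"
    "0 < reward 1 M (policy \<delta>) N (indicator Cause) [] (init M)"
    "reward 1 M (policy \<delta>) N qr [] (init M) \<le> reward 1 M (policy \<delta>) N (indicator Cause) [] (init M) *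
       (reward 1 M (policy \<delta>) N qr [] (init M) + reward 1 M (policy \<delta>) N (indicator Eff) [] (init M))"
proof -
  define p where "p = reward 1 M S N (indicator Cause) [] (init M)"
  define q where "q = reward 1 M S N qr [] (init M)"
  define e where "e = reward 1 M S N (indicator Eff) [] (init M)"
  define t where "t = reward 1 M S NT (indicator Eff) [] (init M)"
  have v: "valid M NT S" using S(1) by (simp add: is_scheduler_iff)
  have p: "0 < p" using S(2) by (simp add: p_def Pr_Cause[OF S(1)])
  have p1: "p \<le> 1" unfolding p_def
    by (rule N.reward_le[OF valid_N[OF v]]) (auto simp: init indicator_def)
  have "(t + p - (p + e)) / p \<le> t"
    using S(3) unfolding Pr_cond_reach[OF is_mdp S(1)] Pr_Cause[OF S(1)] Pr_Eff[OF S(1)] Pr_Eff_Cause[OF S(1)]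
    by (simp add: p_def e_def t_def)
  then have "t * (1 - p) \<le> e" using p by (simp add: divide_le_eq algebra_simps)
  moreover have "(q + e) * (1 - p) \<le> t * (1 - p)"
    using reward_qr_Eff_le[OF v init] p1 by (intro mult_right_mono) (auto simp: q_def e_def t_def)
  ultimately have "q \<le> p * (q + e)" by (simp add: algebra_simps)
  then show thesis
    using N.memoryless_suffices[OF valid_N[OF v] init, of qr "indicator Cause" "indicator Eff"] that p
    by (force simp: p_def q_def e_def qr_def m_bounds indicator_def)
qed

text \<open>The memory records whether a cause has been visited. Before that \<open>T\<close>
  imitates \<open>\<delta>\<close>, afterwards \<open>dmin\<close>, so the value at the first cause
  is exactly \<open>m\<close>.\<close>

lemma two_memory_counterexample:
  assumes \<delta>: "\<And>s. s \<in> N \<Longrightarrow> set_pmf (\<delta> s) \<subseteq> enabled M s"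
    and pos: "0 < reward 1 M (policy \<delta>) N (indicator Cause) [] (init M)"
    and le: "reward 1 M (policy \<delta>) N qr [] (init M) \<le> reward 1 M (policy \<delta>) N (indicator Cause) [] (init M) *
       (reward 1 M (policy \<delta>) N qr [] (init M) + reward 1 M (policy \<delta>) N (indicator Eff) [] (init M))"
  shows "\<exists>T. is_scheduler M T \<and> finite_memory 2 T \<and> Pr M T (reach M Cause) > 0 \<and>
    Pr_cond M T (reach M Eff) (reach M Cause) \<le> Pr M T (reach M Eff)"
proof -
  \<comment> \<open>The history excludes the current state, which is tested separately: the cell
    changes only when a cause is left, but the choice in the cause already depends on it.\<close>
  define after where "after h s \<longleftrightarrow> (\<exists>x\<in>set h. fst x \<in> Cause) \<or> s \<in> Cause" for h :: "('s \<times> 'a) list" and s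
  define T where "T h s = (if after h s then return_pmf (dmin s) else \<delta> s)" for h s
  have v: "valid M NT T"
    using \<delta> dmin by (auto simp: valid_def T_def after_def N_def)
  have T: "is_scheduler M T" using v by (simp add: is_scheduler_iff)
  define upd where "upd c x = (if c = 1 \<or> fst x \<in> Cause then 1 else 0 :: nat)" for c :: nat and x :: "'s \<times> 'a"
  have "foldl upd c h = (if c = 1 \<or> (\<exists>x\<in>set h. fst x \<in> Cause) then 1 else 0)" if "c < 2" for c h
    using that by (induction h arbitrary: c) (auto simp: upd_def less_2_cases_iff)
  then have "T h s = (if foldl upd 0 h = 1 \<or> s \<in> Cause then return_pmf (dmin s) else \<delta> s)" for h s
    by (simp add: T_def after_def)
  then have mem: "finite_memory 2 T"
    unfolding finite_memory_def
    by (intro exI[of _ 0] exI[of _ upd] exI[of _ "\<lambda>c s. if c = 1 \<or> s \<in> Cause then return_pmf (dmin s) else \<delta> s"])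
       (auto simp: upd_def)
  have before: "reward 1 M T N f [] s = reward 1 M (policy \<delta>) N f [] s" for f s
    by (rule reward_cong[where J = "\<lambda>h _ _. \<forall>x\<in>set h. fst x \<notin> Cause"])
       (auto simp: T_def after_def policy_def N_def)
  have later: "reward 1 M T NT (indicator Eff) h s = m s" if "s \<in> Cause" for h s
    unfolding m_def
    by (rule reward_cong[where J = "\<lambda>h _. after h"]) (use that in \<open>auto simp: after_def T_def md_def policy_def\<close>)
  have "reward 1 M T NT (indicator Eff) [] (init M) = reward 1 M T N (\<lambda>s. qr s + indicator Eff s) [] (init M)"
  proof (rule reward_stop_at[OF NT.stopped_mdp_axioms _ v])
    show "reward 1 M T NT (indicator Eff) h s = qr s + indicator Eff s" if "s \<in> NT - N" for h s
    proof -
      have "s \<in> Cause" "s \<notin> Eff" using that Eff(2)[of s] by (auto simp: N_def NT_def)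
      then show ?thesis using later by (simp add: qr_def)
    qed
  qed (use init Cause in \<open>auto simp: N_def qr_def m_outside indicator_def\<close>)
  also have "\<dots> = reward 1 M (policy \<delta>) N qr [] (init M) + reward 1 M (policy \<delta>) N (indicator Eff) [] (init M)"
    using N.reward_add[OF valid_N[OF v] init, of 1] by (simp add: before)
  finally have total: "Pr M T (reach M Eff) = \<dots>" by (simp add: Pr_Eff[OF T])
  have "Pr_cond M T (reach M Eff) (reach M Cause) \<le> Pr M T (reach M Eff)"
    unfolding Pr_cond_reach[OF is_mdp T] Pr_Eff_Cause[OF T] total
    using le pos by (simp add: Pr_Cause[OF T] before divide_le_eq mult.commute)
  then show ?thesis using T mem pos by (auto simp: Pr_Cause before)
qed

end

section \<open>The minimised process\<close>

locale min_mdp_setup = cause_effect M Eff Cause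
  for M :: "('s, 'a) mdp" and Eff Cause :: "'s set" +
  fixes eff :: 's and noeff :: "'s option" and Mmin :: "('s option, 'a option) mdp"
  assumes eff: "eff \<in> Eff"
    and noeff: "noeff \<in> insert None (Some ` (states M - Eff))"
    and Mmin: "Mmin = min_mdp M Cause Eff eff noeff"
    and noeff_terminal: "terminal Mmin noeff"
begin

lemma Mmin_sel: "states Mmin = insert noeff (Some ` states M)" "acts Mmin = insert None (Some ` acts M)"
  "init Mmin = Some (init M)"
  by (simp_all add: Mmin min_mdp_def)

lemma finite_M: "finite (states M)" "finite (acts M)"
  using NT.finite_states NT.finite_acts .

lemma Mmin_sum:
  "(\<Sum>t\<in>states Mmin. f t) = (\<Sum>t\<in>states M. f (Some t)) + (if noeff = None then f None else (0::real))"
proof (cases noeff)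
  case None
  then show ?thesis using finite_M by (simp add: Mmin_sel sum.reindex add.commute)
next
  case (Some t)
  then have "states Mmin = Some ` states M" using noeff by (auto simp: Mmin_sel)
  then show ?thesis using Some by (simp add: sum.reindex)
qed

lemma trans_Mmin:
  "trans_prob Mmin None a t = 0"
  "s \<notin> Cause \<Longrightarrow> trans_prob Mmin (Some s) (Some \<alpha>) (Some v) = trans_prob M s \<alpha> v"
  "trans_prob Mmin (Some s) (Some \<alpha>) None = 0"
  "s \<in> Cause \<Longrightarrow> trans_prob Mmin (Some s) (Some \<alpha>) t = 0"
  "s \<notin> Cause \<Longrightarrow> trans_prob Mmin (Some s) None t = 0"
  "s \<in> Cause \<Longrightarrow> trans_prob Mmin (Some s) None t =
     (if t = Some eff then m s else if t = noeff then 1 - m s else 0)"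
  using Cause by (auto simp: Mmin min_mdp_def Pr_min_Eff split: option.split)

lemma noeff_neq: "noeff \<noteq> Some eff"
  using noeff eff by auto

lemma Mmin_sum_gamma:
  assumes "s \<in> Cause"
  shows "(\<Sum>t\<in>states Mmin. trans_prob Mmin (Some s) None t * f t) = m s * f (Some eff) + (1 - m s) * f noeff"
proof -
  have fin: "finite (states Mmin)" and e: "Some eff \<in> states Mmin" and n: "noeff \<in> states Mmin - {Some eff}"
    using finite_M eff Eff noeff_neq by (auto simp: Mmin_sel)
  show ?thesis
    unfolding sum.remove[OF fin e] sum.remove[OF finite_Diff[OF fin] n]
    using assms noeff_neq by (simp add: trans_Mmin)
qed

lemma Mmin_sum_Some:
  assumes "s \<notin> Cause"
  shows "(\<Sum>t\<in>states Mmin. trans_prob Mmin (Some s) (Some a) t * f t) = (\<Sum>t\<in>states M. trans_prob M s a t * f (Some t))"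
  unfolding Mmin_sum using assms by (simp add: trans_Mmin)

lemma enabled_Mmin:
  "s \<notin> Cause \<Longrightarrow> enabled Mmin (Some s) = Some ` enabled M s"
  "s \<in> Cause \<Longrightarrow> enabled Mmin (Some s) = {None}"
  "enabled Mmin None = {}"
proof -
  show "enabled Mmin (Some s) = Some ` enabled M s" if "s \<notin> Cause"
    using Mmin_sum_Some[OF that, of _ "\<lambda>_. 1"] that by (auto simp: enabled_def Mmin_sel(2) trans_Mmin)
  show "enabled Mmin (Some s) = {None}" if "s \<in> Cause"
    using Mmin_sum_gamma[OF that, of "\<lambda>_. 1"] that by (auto simp: enabled_def Mmin_sel(2) trans_Mmin(4))
  show "enabled Mmin None = {}" by (simp add: enabled_def trans_Mmin)
qed

lemma is_mdp_Mmin: "is_mdp Mmin"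
proof -
  have "(\<forall>t\<in>states Mmin. 0 \<le> trans_prob Mmin s a t \<and> trans_prob Mmin s a t \<le> 1) \<and>
      (\<Sum>t\<in>states Mmin. trans_prob Mmin s a t) \<in> {0, 1}"
    if s: "s \<in> states Mmin" and a: "a \<in> acts Mmin" for s a
  proof (cases s)
    case None
    then show ?thesis by (simp add: trans_Mmin)
  next
    case (Some u)
    then have u: "u \<in> states M" using s noeff by (auto simp: Mmin_sel)
    show ?thesis
    proof (cases "u \<in> Cause")
      case True
      then show ?thesis
        using Some Mmin_sum_gamma[OF True, of "\<lambda>_. 1"] m_bounds[OF u] by (cases a) (auto simp: trans_Mmin)
    next
      case False
      show ?thesis
      proof (cases a)
        case None
        then show ?thesis using Some False by (simp add: trans_Mmin)
      next
        case (Some \<alpha>)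
        then have \<alpha>: "\<alpha> \<in> acts M" using a by (auto simp: Mmin_sel)
        have M: "0 \<le> trans_prob M u \<alpha> v \<and> trans_prob M u \<alpha> v \<le> 1" if "v \<in> states M" for v
          using is_mdp u \<alpha> that by (auto simp: is_mdp_def)
        have "(\<Sum>t\<in>states M. trans_prob M u \<alpha> t) \<in> {0, 1}"
          using is_mdp u \<alpha> by (auto simp: is_mdp_def)
        moreover have "0 \<le> trans_prob Mmin s a t \<and> trans_prob Mmin s a t \<le> 1" if "t \<in> states Mmin" for t
        proof (cases t)
          case None
          then show ?thesis using \<open>s = Some u\<close> Some by (simp add: trans_Mmin)
        next
          case (Some v)
          then have "v \<in> states M" using that noeff by (auto simp: Mmin_sel)
          then show ?thesis using M \<open>s = Some u\<close> \<open>a = Some \<alpha>\<close> Some False by (simp add: trans_Mmin)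
        qed
        ultimately show ?thesis
          using \<open>s = Some u\<close> Some Mmin_sum_Some[OF False, of \<alpha> "\<lambda>_. 1"] by auto
      qed
    qed
  qed
  then show ?thesis
    using finite_M init by (auto simp: is_mdp_def Mmin_sel)
qed

text \<open>A cause is never terminal here, even if it is terminal in \<open>M\<close>, because
  \<open>\<gamma>\<close> is enabled in it.\<close>

lemma nonterminal_Mmin: "{s \<in> states Mmin. \<not> terminal Mmin s} = Some ` (N \<union> Cause)"
proof (intro equalityI subsetI)
  fix s assume "s \<in> {s \<in> states Mmin. \<not> terminal Mmin s}"
  then have s: "s \<in> Some ` states M" "enabled Mmin s \<noteq> {}"
    using noeff_terminal by (auto simp: Mmin_sel terminal_def)
  then obtain u where u: "s = Some u" "u \<in> states M" by auto
  then show "s \<in> Some ` (N \<union> Cause)"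
    using s(2) by (cases "u \<in> Cause") (auto simp: enabled_Mmin N_def NT_def terminal_def)
next
  fix s assume "s \<in> Some ` (N \<union> Cause)"
  then obtain u where u: "s = Some u" "u \<in> N \<union> Cause" by auto
  then show "s \<in> {s \<in> states Mmin. \<not> terminal Mmin s}"
    using Cause by (cases "u \<in> Cause") (auto simp: Mmin_sel terminal_def enabled_Mmin N_def NT_def)
qed

lemma noeff_not: "noeff \<notin> Some ` (N \<union> Cause)" "noeff \<notin> Some ` Eff"
  using noeff_terminal nonterminal_Mmin noeff by auto

lemma nonterminal_Mmin_diff:
  "Some ` (N \<union> Cause) - Some ` Cause = Some ` N"
  "Some ` (N \<union> Cause) - Some ` Eff = Some ` (N \<union> Cause)"
  "Some ` (N \<union> Cause) - (Some ` Eff \<union> Some ` Cause) = Some ` N"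
  using Cause Eff(2) by (auto simp: N_def NT_def)

context
  fixes \<delta> :: "'s \<Rightarrow> 'a pmf"
  assumes \<delta>: "\<And>s. s \<in> N \<Longrightarrow> set_pmf (\<delta> s) \<subseteq> enabled M s"
begin

text \<open>Plays \<open>\<delta>\<close> before the causes and the forced \<open>\<gamma>\<close>,
  that is \<open>None\<close>, in them. The choice in the state \<open>None\<close> is a default,
  that state being terminal.\<close>

definition lift :: "'s option \<Rightarrow> 'a option pmf" where
  "lift x = (case x of None \<Rightarrow> return_pmf None
     | Some s \<Rightarrow> if s \<in> Cause then return_pmf None else map_pmf Some (\<delta> s))"

lemma lift_scheduler: "is_scheduler Mmin (policy lift)"
proof -
  have "set_pmf (lift s) \<subseteq> enabled Mmin s" if s: "s \<in> Some ` (N \<union> Cause)" for s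
  proof -
    obtain u where u: "s = Some u" "u \<in> N \<union> Cause" using s by auto
    then show ?thesis
      using \<delta>[of u] by (cases "u \<in> Cause") (auto simp: lift_def enabled_Mmin)
  qed
  then show ?thesis unfolding nonterminal_Mmin[symmetric] by (simp add: is_scheduler_def policy_apply)
qed

text \<open>Up to the first cause both processes take the same steps. The two histories are
  unrelated since both schedulers are memoryless.\<close>

lemma gain_lift:
  assumes "s \<in> states M"
  shows "gain Mmin (policy lift) (Some ` N) f n h (Some s) = gain M (policy \<delta>) N (\<lambda>s. f (Some s)) n h' s"
  using assms
proof (induction n arbitrary: s h h')
  case (Suc n)
  show ?case
  proof (cases "s \<in> N")
    case True
    then have s: "s \<notin> Cause" by (simp add: N_def)
    have "step_exp Mmin (policy lift) (gain Mmin (policy lift) (Some ` N) f n) h (Some s) =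
        (\<Sum>a\<in>acts M. pmf (\<delta> s) a * (\<Sum>t\<in>states M. trans_prob M s a t *
          gain Mmin (policy lift) (Some ` N) f n (h @ [(Some s, Some a)]) (Some t)))"
    proof -
      have "pmf (lift (Some s)) None = 0" "\<And>a. pmf (lift (Some s)) (Some a) = pmf (\<delta> s) a"
        using s by (auto simp: lift_def pmf_map_inj' pmf_eq_0_set_pmf)
      then show ?thesis
        using finite_M by (simp add: step_exp_def Mmin_sel(2) sum.reindex Mmin_sum_Some[OF s] policy_apply)
    qed
    also have "\<dots> = step_exp M (policy \<delta>) (gain M (policy \<delta>) N (\<lambda>s. f (Some s)) n) h' s"
      unfolding step_exp_def
      by (intro sum.cong refl arg_cong2[where f = "(*)"] Suc.IH) (auto simp: policy_apply)
    finally show ?thesis using True by simp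
  qed auto
qed auto

lemma reward_lift:
  assumes "s \<in> states M"
  shows "reward 1 Mmin (policy lift) (Some ` N) f [] (Some s) = reward 1 M (policy \<delta>) N (\<lambda>s. f (Some s)) [] s"
  unfolding reward_def gain_lift[OF assms, where h' = "[]"] ..

text \<open>The three rewards agree with those in \<open>M\<close>: before a cause by
  \<open>reward_lift\<close>, and at a cause because \<open>\<gamma>\<close> yields
  \<open>Eff\<close> with probability \<open>m\<close>, which is what \<open>qr\<close> collects
  there.\<close>

lemma min_mdp_counterexample:
  assumes pos: "0 < reward 1 M (policy \<delta>) N (indicator Cause) [] (init M)"
    and le: "reward 1 M (policy \<delta>) N qr [] (init M) \<le> reward 1 M (policy \<delta>) N (indicator Cause) [] (init M) *
       (reward 1 M (policy \<delta>) N qr [] (init M) + reward 1 M (policy \<delta>) N (indicator Eff) [] (init M))"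
  shows "\<exists>S. is_scheduler Mmin S \<and> memoryless S \<and> Pr Mmin S (reach Mmin (Some ` Cause)) > 0 \<and>
    Pr_cond Mmin S (reach Mmin (Some ` Eff)) (reach Mmin (Some ` Cause)) \<le> Pr Mmin S (reach Mmin (Some ` Eff))"
proof -
  let ?S = "policy lift" and ?G = "Some ` (N \<union> Cause)"
  have sub: "stopped_mdp Mmin ?G" using is_mdp_Mmin by (rule stopped_mdp_nonterminal) (simp add: nonterminal_Mmin)
  interpret G: stopped_mdp Mmin ?G by (rule sub)
  have v: "valid Mmin ?G ?S" using lift_scheduler by (rule is_scheduler_valid) (simp add: nonterminal_Mmin)
  have vN: "valid M N (policy \<delta>)" using \<delta> by (auto simp: valid_def policy_def)
  have ind: "indicator (Some ` A) (Some s) = (indicator A s :: real)" for A :: "'s set" and s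
    by (auto simp: indicator_def)
  have cause: "Pr Mmin ?S (reach Mmin (Some ` Cause)) = reward 1 M (policy \<delta>) N (indicator Cause) [] (init M)"
    unfolding Pr_reach[OF is_mdp_Mmin lift_scheduler] nonterminal_Mmin nonterminal_Mmin_diff Mmin_sel(3)
      reward_lift[OF init] ind ..
  have both: "Pr Mmin ?S (reach Mmin (Some ` Eff \<union> Some ` Cause)) =
      reward 1 M (policy \<delta>) N (indicator Cause) [] (init M) + reward 1 M (policy \<delta>) N (indicator Eff) [] (init M)"
    unfolding Pr_reach[OF is_mdp_Mmin lift_scheduler] nonterminal_Mmin nonterminal_Mmin_diff Mmin_sel(3)
      reward_lift[OF init]
    unfolding image_Un[symmetric] ind indicator_union
    by (rule N.reward_add[OF vN init]) simp_all
  \<comment> \<open>Both successors under \<open>\<gamma>\<close> lie outside \<open>?G\<close>,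
    where the reward is read off at once: 1 in \<open>eff\<close> and 0 in
    \<open>noeff\<close>.\<close>
  have gamma: "reward 1 Mmin ?S ?G (indicator (Some ` Eff)) h (Some c) = m c" if c: "c \<in> Cause" for h c
  proof -
    have "eff \<notin> N \<union> Cause" using eff Eff(2) Cause by (auto simp: N_def NT_def)
    then have "reward 1 Mmin ?S ?G (indicator (Some ` Eff)) h' (Some eff) = 1" for h'
      using eff by (subst G.reward_outside) auto
    moreover have "reward 1 Mmin ?S ?G (indicator (Some ` Eff)) h' noeff = 0" for h'
      using noeff_not by (subst G.reward_outside) auto
    moreover have "reward 1 Mmin ?S ?G (indicator (Some ` Eff)) h (Some c) =
        step_exp Mmin ?S (reward 1 Mmin ?S ?G (indicator (Some ` Eff))) h (Some c)"
      using G.reward_step[OF v, of "Some c" 1] c by simp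
    moreover have "\<dots> = (\<Sum>t\<in>states Mmin. trans_prob Mmin (Some c) None t *
        reward 1 Mmin ?S ?G (indicator (Some ` Eff)) (h @ [(Some c, None)]) t)"
      using c by (intro G.step_exp_return) (auto simp: policy_apply lift_def Mmin_sel)
    ultimately show ?thesis by (simp only: Mmin_sum_gamma[OF c])
  qed
  have "reward 1 Mmin ?S ?G (indicator (Some ` Eff)) [] (Some (init M)) =
      reward 1 Mmin ?S (Some ` N) (\<lambda>x. case x of None \<Rightarrow> 0 | Some s \<Rightarrow> qr s + indicator Eff s) [] (Some (init M))"
  proof (rule reward_stop_at[OF sub _ v])
    fix h x assume "x \<in> ?G - Some ` N"
    then obtain c where "x = Some c" "c \<in> Cause" by auto
    then show "reward 1 Mmin ?S ?G (indicator (Some ` Eff)) h x = (case x of None \<Rightarrow> 0 | Some s \<Rightarrow> qr s + indicator Eff s)"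
      using gamma Cause by (auto simp: qr_def)
  next
    fix x assume "x \<in> states Mmin - ?G"
    then show "(case x of None \<Rightarrow> 0 | Some s \<Rightarrow> qr s + indicator Eff s) = (indicator (Some ` Eff) x :: real)"
      by (auto simp: qr_def indicator_def split: option.split)
  qed (use init in \<open>auto simp: Mmin_sel\<close>)
  also have "\<dots> = reward 1 M (policy \<delta>) N qr [] (init M) + reward 1 M (policy \<delta>) N (indicator Eff) [] (init M)"
    unfolding reward_lift[OF init] using N.reward_add[OF vN init, of 1] by simp
  finally have total: "Pr Mmin ?S (reach Mmin (Some ` Eff)) = \<dots>"
    unfolding Pr_reach[OF is_mdp_Mmin lift_scheduler] nonterminal_Mmin nonterminal_Mmin_diff Mmin_sel(3) .
  have "Pr_cond Mmin ?S (reach Mmin (Some ` Eff)) (reach Mmin (Some ` Cause)) \<le> Pr Mmin ?S (reach Mmin (Some ` Eff))"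
    unfolding Pr_cond_reach[OF is_mdp_Mmin lift_scheduler] both total cause
    using le pos by (simp add: divide_le_eq mult.commute)
  moreover have "memoryless ?S" by (auto simp: memoryless_def policy_def)
  ultimately show ?thesis using lift_scheduler pos cause by auto
qed

end

end

theorem theorem3:
  fixes M :: "('s, 'a) mdp" and Eff Cause :: "'s set" and eff :: 's and noeff :: "'s option"
    and Mmin :: "('s option, 'a option) mdp"
  assumes "is_mdp M"
    and "\<forall>s\<in>states M. (init M, s) \<in> (edges M)\<^sup>*"
    and "Eff \<subseteq> states M - {init M}" and "Eff \<noteq> {}" and "\<forall>s\<in>Eff. terminal M s"
    and "Cause \<subseteq> states M - Eff" and "Cause \<noteq> {}"
    and "cond_M M Cause"
    and "eff \<in> Eff"
    and "noeff \<in> insert None (Some ` (states M - Eff))"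
    and "Mmin = min_mdp M Cause Eff eff noeff"
    and "terminal Mmin noeff"
    and "\<not> GPR_cause M Cause Eff"
  shows "(\<exists>\<SS>. is_scheduler Mmin \<SS> \<and> memoryless \<SS> \<and>
            Pr Mmin \<SS> (reach Mmin (Some ` Cause)) > 0 \<and>
            Pr_cond Mmin \<SS> (reach Mmin (Some ` Eff)) (reach Mmin (Some ` Cause))
              \<le> Pr Mmin \<SS> (reach Mmin (Some ` Eff))) \<and>
         (\<exists>\<TT>. is_scheduler M \<TT> \<and> finite_memory 2 \<TT> \<and>
            Pr M \<TT> (reach M Cause) > 0 \<and>
            Pr_cond M \<TT> (reach M Eff) (reach M Cause) \<le> Pr M \<TT> (reach M Eff))"
proof -
  interpret min_mdp_setup M Eff Cause eff noeff Mmin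
    using assms by unfold_locales auto
  \<comment> \<open>As (M) holds, it is (G) that fails.\<close>
  obtain \<SS> where "is_scheduler M \<SS>" "0 < Pr M \<SS> (reach M Cause)"
    "Pr_cond M \<SS> (reach M Eff) (reach M Cause) \<le> Pr M \<SS> (reach M Eff)"
    using assms(8,13) by (auto simp: GPR_cause_def cond_G_def not_less)
  then obtain \<delta> where \<delta>: "\<And>s. s \<in> N \<Longrightarrow> set_pmf (\<delta> s) \<subseteq> enabled M s"
    "0 < reward 1 M (policy \<delta>) N (indicator Cause) [] (init M)"
    "reward 1 M (policy \<delta>) N qr [] (init M) \<le> reward 1 M (policy \<delta>) N (indicator Cause) [] (init M) *
       (reward 1 M (policy \<delta>) N qr [] (init M) + reward 1 M (policy \<delta>) N (indicator Eff) [] (init M))"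
    by (rule memoryless_counterexample) (rule that)
  show ?thesis
    using min_mdp_counterexample[OF \<delta>] two_memory_counterexample[OF \<delta>] by (rule conjI)
qed

end
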